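(* For any $\epsilon>0$, there exist $\delta=O(\epsilon/\log(k/\epsilon^2))$ (with $k=2$) and $d=O(1/\epsilon^2)$ such that every $(\epsilon,1/2-\epsilon)$-tester for 2-XOR with degree bound $d$ requires $\Omega(n^{1/2+\delta})$ queries, where $n$ is the number of variables.
   Context: 2-XOR is CSP($P$) for the predicate $P:\{0,1\}^2\to\{0,1\}$ with $P(x_1,x_2)=1$ iff $x_1\oplus x_2=1$. An instance of CSP($P$) consists of Boolean variables and constraints, each on a pair of variables $(x_1,x_2)$ and of the form $P(x_1+b_1,x_2+b_2)=1$ for some literal vector $b\in\{0,1\}^2$ (addition mod 2). Bounded-degree model with degree bound $d$: each variable appears in at most $d$ constraints; an algorithm accesses the instance only via an oracle that, given a variable $x$ and an index $1\le i\le d$, returns the $i$-th constraint containing $x$ (or a special symbol if none exists); query complexity is the number of oracle calls. An instance is $\epsilon$-far from satisfiability if at least $\epsilon dn/k$ constraints (here $k=2$) must be removed to make it satisfiable, and $\epsilon$-close if removing at most $\epsilon dn/k$ constraints suffices. A $(\gamma,\epsilon)$-tester is a randomized algorithm that accepts with probability at least $2/3$ every instance $\gamma$-close to satisfiability and rejects with probability at least $2/3$ every instance $\epsilon$-far from satisfiability. *)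

theory Defs
  imports "HOL-Probability.Probability_Mass_Function" "HOL-Library.Landau_Symbols"
begin

text \<open>
  Instances of CSP(P) for a binary predicate \<open>P\<close> in the bounded-degree model.  Variables are
  \<open>0, \<dots>, n - 1\<close>.  A constraint \<open>((x, y), (a, b))\<close> stands for \<open>P (x + a) (y + b) = 1\<close>;
  on type \<open>bool\<close>, addition modulo 2 is \<open>\<noteq>\<close>.
\<close>

type_synonym csp_constraint = "(nat \<times> nat) \<times> (bool \<times> bool)"

fun constraint_vars :: "csp_constraint \<Rightarrow> nat set" where
  "constraint_vars ((x, y), _) = {x, y}"

fun constraint_sat :: "(bool \<Rightarrow> bool \<Rightarrow> bool) \<Rightarrow> (nat \<Rightarrow> bool) \<Rightarrow> csp_constraint \<Rightarrow> bool" where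
  "constraint_sat P s ((x, y), (a, b)) = P (s x \<noteq> a) (s y \<noteq> b)"

definition xor2 :: "bool \<Rightarrow> bool \<Rightarrow> bool" where
  "xor2 x y \<longleftrightarrow> x \<noteq> y"

text \<open>
  Constraints may occur repeatedly, so they are kept in a list and identified by their position.
  The list \<open>incident I x\<close> fixes the (arbitrary) order in which the oracle reports the
  constraints containing \<open>x\<close>.
\<close>

record csp_instance =
  constraints :: "csp_constraint list"
  incident :: "nat \<Rightarrow> nat list"

definition bounded_degree_instances :: "nat \<Rightarrow> nat \<Rightarrow> csp_instance set" where
  "bounded_degree_instances n d = {I.
     (\<forall>((x, y), b) \<in> set (constraints I). x < n \<and> y < n \<and> x \<noteq> y) \<and>
     (\<forall>x. distinct (incident I x) \<and>
          set (incident I x) =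
            {j. j < length (constraints I) \<and> x \<in> constraint_vars (constraints I ! j)} \<and>
          length (incident I x) \<le> d)}"

text \<open>Indices are 1-based; \<open>None\<close> is the special symbol.\<close>

definition csp_oracle :: "csp_instance \<Rightarrow> nat \<Rightarrow> nat \<Rightarrow> csp_constraint option" where
  "csp_oracle I x i =
     (if 1 \<le> i \<and> i \<le> length (incident I x)
      then Some (constraints I ! (incident I x ! (i - 1))) else None)"

definition satisfiable_without :: "(bool \<Rightarrow> bool \<Rightarrow> bool) \<Rightarrow> csp_instance \<Rightarrow> nat set \<Rightarrow> bool" where
  "satisfiable_without P I R \<longleftrightarrow>
     (\<exists>s. \<forall>j \<in> {..<length (constraints I)} - R. constraint_sat P s (constraints I ! j))"

definition close_to_sat ::
    "(bool \<Rightarrow> bool \<Rightarrow> bool) \<Rightarrow> nat \<Rightarrow> nat \<Rightarrow> real \<Rightarrow> csp_instance \<Rightarrow> bool" where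
  "close_to_sat P n d \<epsilon> I \<longleftrightarrow>
     (\<exists>R \<subseteq> {..<length (constraints I)}.
        satisfiable_without P I R \<and> real (card R) \<le> \<epsilon> * real d * real n / 2)"

definition far_from_sat ::
    "(bool \<Rightarrow> bool \<Rightarrow> bool) \<Rightarrow> nat \<Rightarrow> nat \<Rightarrow> real \<Rightarrow> csp_instance \<Rightarrow> bool" where
  "far_from_sat P n d \<epsilon> I \<longleftrightarrow>
     (\<forall>R \<subseteq> {..<length (constraints I)}.
        satisfiable_without P I R \<longrightarrow> real (card R) \<ge> \<epsilon> * real d * real n / 2)"

text \<open>
  A deterministic adaptive algorithm is a decision tree whose inner nodes are oracle calls;
  a randomized algorithm is a probability distribution on such trees.
\<close>

datatype oracle_alg =
    Answer bool
  | Query nat nat "csp_constraint option \<Rightarrow> oracle_alg"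

primrec accepts :: "csp_instance \<Rightarrow> oracle_alg \<Rightarrow> bool" where
  "accepts I (Answer b) = b"
| "accepts I (Query x i f) = accepts I (f (csp_oracle I x i))"

primrec num_queries :: "csp_instance \<Rightarrow> oracle_alg \<Rightarrow> nat" where
  "num_queries I (Answer b) = 0"
| "num_queries I (Query x i f) = Suc (num_queries I (f (csp_oracle I x i)))"

definition csp_tester ::
    "(bool \<Rightarrow> bool \<Rightarrow> bool) \<Rightarrow> nat \<Rightarrow> nat \<Rightarrow> real \<Rightarrow> real \<Rightarrow> oracle_alg pmf \<Rightarrow> bool" where
  "csp_tester P n d \<gamma> \<epsilon> A \<longleftrightarrow>
     (\<forall>I \<in> bounded_degree_instances n d.
        (close_to_sat P n d \<gamma> I \<longrightarrow> measure_pmf.prob A {t. accepts I t} \<ge> 2/3) \<and>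
        (far_from_sat P n d \<epsilon> I \<longrightarrow> measure_pmf.prob A {t. \<not> accepts I t} \<ge> 2/3))"

text \<open>Worst case over both the instance and the coin tosses.\<close>

definition query_bound :: "nat \<Rightarrow> nat \<Rightarrow> oracle_alg pmf \<Rightarrow> nat \<Rightarrow> bool" where
  "query_bound n d A q \<longleftrightarrow>
     (\<forall>I \<in> bounded_degree_instances n d. \<forall>t \<in> set_pmf A. num_queries I t \<le> q)"

end

theory Submission
  imports Defs "HOL-Combinatorics.Transposition" "HOL-Real_Asymp.Real_Asymp"
begin

text \<open>
  Take a random bipartite \<open>d\<close>-regular multigraph, the union of \<open>d\<close> random perfect
  matchings.  With uniform labels the instance is far from satisfiable by an exponential moment and
  a union bound, as \<open>d\<close> is of order \<open>1/\<epsilon>\<^sup>2\<close>.  In the planted instance each edge is good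
  with probability \<open>1 - 1/M\<close>, \<open>M\<close> of order \<open>1/\<epsilon>\<close>; good edges get the label satisfied by a
  hidden random assignment and the others a uniform one, so the instance is close to satisfiable.

  As long as the good edges seen so far form a forest, the labels seen in both models are uniform,
  so the algorithm must find a cycle of good edges.  With \<open>q\<close> queries only about \<open>q\<^sup>2/n\<close> edges
  run into a vertex visited before; the remaining ones form a forest of parent pointers, in which a
  vertex has \<open>r\<close> consecutive good parent edges with probability \<open>(1 - 1/M)^r\<close>.  Hence good
  components have expected size about \<open>(1 + q\<^sup>2/n) (r\<^sup>2 d^r + q (1 - 1/M)^r)\<close>, which for
  \<open>r = ln n / (8 ln d)\<close> and \<open>q \<le> n powr (1/2 + \<delta>)\<close> is so far below \<open>n/q\<close> that with high
  probability no good edge closes a cycle.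
\<close>

text \<open>The exploration is always run with uniform labels, never with planted ones. A transcript
  without a good cycle has the same probability in both models, so planted rejections are at least
  as frequent as uniform rejections along acyclic histories, and this single inequality carries the
  comparison. The gain is independence: the history depends on matchings and labels only, so for a
  fixed history the marks that decide goodness can be averaged afterwards. The matchings cannot be
  averaged this way, because the queries adapt to the answers. They are handled by a supermartingale
  that compares how often an answer falls into a set fixed before the query with the size of that
  set.

  The obstacle above \<open>sqrt n\<close> queries is that the explored graph does contain cycles;
  the proof only shows that good ones are unlikely. A surplus edge may join any two trees, so the
  components at all surplus ends are lumped together with that of the queried vertex.

  All probabilities are cardinalities of finite sets; this is why goodness comes from uniform
  integer marks. Bipartiteness excludes loops and gives each edge a canonical name, its left
  end.\<close>

lemma card_half:
  assumes "finite P" and f: "\<And>p. p \<in> P \<Longrightarrow> f p \<in> P \<and> f (f p) = p \<and> (b (f p) \<longleftrightarrow> \<not> b p)"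
  shows "2 * card {p \<in> P. b p = c} = card P"
proof -
  have "bij_betw f {p \<in> P. b p = c} {p \<in> P. b p \<noteq> c}"
    by (rule bij_betw_byWitness[where f' = f]) (use f in auto)
  then have "card {p \<in> P. b p = c} = card {p \<in> P. b p \<noteq> c}"
    by (rule bij_betw_same_card)
  moreover have "card P = card {p \<in> P. b p = c} + card {p \<in> P. b p \<noteq> c}"
    using assms(1) by (subst card_Un_disjoint[symmetric]) (auto intro: arg_cong[where f = card])
  ultimately show ?thesis by simp
qed

text \<open>A randomized algorithm is a mixture of decision trees, so an inequality valid for every
  tree in its support survives averaging. Below, \<open>X\<close> indexes the planted and
  \<open>Y\<close> the uniform instances, and the combinatorics deals with one fixed tree.\<close>

lemma pmf_average_compare:
  fixes A :: "'a pmf" and c b :: real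
  assumes fin: "finite X" "finite Y"
    and le: "\<And>t. t \<in> set_pmf A \<Longrightarrow> c * (\<Sum>y\<in>Y. of_bool (Q y t)) - b \<le> (\<Sum>x\<in>X. of_bool (P x t))"
  shows "c * (\<Sum>y\<in>Y. measure_pmf.prob A {t. Q y t}) - b \<le> (\<Sum>x\<in>X. measure_pmf.prob A {t. P x t})"
proof -
  have int: "integrable (measure_pmf A) (\<lambda>t. of_bool (R t) :: real)" for R
    by (rule measure_pmf.integrable_const_bound[where B = 1]) auto
  have E: "measure_pmf.expectation A (\<lambda>t. of_bool (R t)) = measure_pmf.prob A {t. R t}" for R
  proof -
    have "(\<lambda>t. of_bool (R t) :: real) = indicator {t. R t}" by (auto simp: indicator_def)
    then show ?thesis by simp
  qed
  have "measure_pmf.expectation A (\<lambda>t. c * (\<Sum>y\<in>Y. of_bool (Q y t)) - b)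
      \<le> measure_pmf.expectation A (\<lambda>t. \<Sum>x\<in>X. of_bool (P x t))"
    by (rule integral_mono_AE) (auto simp: int AE_measure_pmf_iff le)
  then show ?thesis by (simp add: int E)
qed

text \<open>After taking out the factor \<open>exp (- a)\<close> this says
  \<open>cosh a \<le> exp (a\<^sup>2)\<close>. The left-hand side is, up to normalisation, the
  exponential moment of a single random label.\<close>

lemma cosh_bound:
  assumes "0 \<le> a" "a \<le> (1::real)"
  shows "1 + exp (- (2 * a)) \<le> 2 * exp (a\<^sup>2 - a)"
proof -
  have 1: "exp a \<le> 1 + a + a\<^sup>2" using assms by (intro exp_bound)
  have "exp (- a) \<le> 1 / (1 + a)"
    using exp_ge_add_one_self[of a] assms by (simp add: exp_minus field_simps)
  also have "\<dots> \<le> 1 - a + a\<^sup>2"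
  proof -
    have "(1 - a + a\<^sup>2) * (1 + a) = 1 + a ^ 3" by (simp add: power2_eq_square power3_eq_cube algebra_simps)
    then show ?thesis using assms by (simp add: pos_divide_le_eq)
  qed
  finally have 2: "exp (- a) \<le> 1 - a + a\<^sup>2" .
  have "exp a + exp (- a) \<le> 2 * (1 + a\<^sup>2)" using 1 2 by simp
  also have "\<dots> \<le> 2 * exp (a\<^sup>2)" by (rule mult_left_mono[OF exp_ge_add_one_self]) simp
  finally have "exp (- a) * (exp a + exp (- a)) \<le> exp (- a) * (2 * exp (a\<^sup>2))" by (intro mult_left_mono) auto
  moreover have "exp (- a) * (exp a + exp (- a)) = 1 + exp (- (2 * a))"
    by (simp add: distrib_left flip: exp_add)
  moreover have "exp (- a) * (2 * exp (a\<^sup>2)) = 2 * exp (a\<^sup>2 - a)" by (simp flip: exp_add)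
  ultimately show ?thesis by simp
qed

text \<open>The edge \<open>(j, a)\<close> is the edge of the \<open>j\<close>-th matching at the left vertex \<open>a\<close>.  The entry
  \<open>(v, j, y)\<close> of a history records that \<open>y\<close> was returned as the \<open>j\<close>-th neighbour of \<open>v\<close>; only
  queries revealing a new edge are recorded, latest first.\<close>

type_synonym edge = "nat \<times> nat"
type_synonym history = "(nat \<times> nat \<times> nat) list"

subsection \<open>Labelled unions of matchings\<close>

locale regular_instances =
  fixes m d :: nat
begin

definition edges :: "edge set" where
  "edges = {..<d} \<times> {..<m}"

text \<open>A matching is stored as a side-swapping involution on all vertices, the left ones being
  \<open>{..<m}\<close>, so that queries from both sides read the same function. Different matchings
  may share an edge, which gives parallel constraints.\<close>

definition matchings :: "(nat \<times> nat \<Rightarrow> nat) set" where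
  "matchings = {\<sigma> \<in> {..<d} \<times> {..<2*m} \<rightarrow>\<^sub>E {..<2*m}.
     \<forall>j<d. \<forall>v<2*m. (v < m) \<noteq> (\<sigma> (j, v) < m) \<and> \<sigma> (j, \<sigma> (j, v)) = v}"

definition labellings :: "(edge \<Rightarrow> bool) set" where
  "labellings = edges \<rightarrow>\<^sub>E UNIV"

definition assignments :: "(nat \<Rightarrow> bool) set" where
  "assignments = {..<2*m} \<rightarrow>\<^sub>E UNIV"

text \<open>Position \<open>j * m + a\<close> holds the edge \<open>(j, a)\<close>. With the label
  in the second literal, the constraint holds iff the label tells correctly whether the endpoints
  have equal values. Incidence lists follow the order of the matchings, so oracle index
  \<open>i\<close> always refers to matching \<open>i - 1\<close>. For odd \<open>n\<close> one
  variable stays isolated.\<close>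

definition labelled_graph :: "(nat \<times> nat \<Rightarrow> nat) \<Rightarrow> (edge \<Rightarrow> bool) \<Rightarrow> csp_instance" where
  "labelled_graph \<sigma> u = \<lparr>
     constraints = map (\<lambda>k. ((k mod m, \<sigma> (k div m, k mod m)), (False, u (k div m, k mod m)))) [0..<d * m],
     incident = (\<lambda>x. if x < 2*m
       then map (\<lambda>j. j * m + (if x < m then x else \<sigma> (j, x))) [0..<d] else [])\<rparr>"

definition edge_key :: "nat \<Rightarrow> nat \<Rightarrow> nat \<Rightarrow> edge" where
  "edge_key v j y = (j, if v < m then v else y)"

definition touched :: "history \<Rightarrow> nat \<Rightarrow> nat set" where
  "touched h j = {v. \<exists>y. (v, j, y) \<in> set h \<or> (y, j, v) \<in> set h}"

text \<open>A query to a known edge has a forced answer. Leaving it out makes every recorded edge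
  fresh, which the halving and independence arguments rely on.\<close>

primrec explore :: "(nat \<times> nat \<Rightarrow> nat) \<Rightarrow> (edge \<Rightarrow> bool) \<Rightarrow> oracle_alg \<Rightarrow> history \<Rightarrow> history" where
  "explore \<sigma> u (Answer b) h = h"
| "explore \<sigma> u (Query x i f) h =
     explore \<sigma> u (f (csp_oracle (labelled_graph \<sigma> u) x i))
       (if x < 2*m \<and> 1 \<le> i \<and> i \<le> d \<and> x \<notin> touched h (i - 1)
        then (x, i - 1, \<sigma> (i - 1, x)) # h else h)"

lemma matchings_lt: "\<sigma> \<in> matchings \<Longrightarrow> j < d \<Longrightarrow> v < 2*m \<Longrightarrow> \<sigma> (j, v) < 2*m"
  by (auto simp: matchings_def PiE_def Pi_def)

lemma matchings_side: "\<sigma> \<in> matchings \<Longrightarrow> j < d \<Longrightarrow> v < 2*m \<Longrightarrow> \<sigma> (j, v) < m \<longleftrightarrow> \<not> v < m"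
  by (auto simp: matchings_def)

lemma matchings_involution: "\<sigma> \<in> matchings \<Longrightarrow> j < d \<Longrightarrow> v < 2*m \<Longrightarrow> \<sigma> (j, \<sigma> (j, v)) = v"
  by (auto simp: matchings_def)

lemma finite_edges [simp]: "finite edges"
  by (simp add: edges_def)

lemma finite_matchings [simp]: "finite matchings"
  unfolding matchings_def by (rule finite_subset[OF _ finite_PiE[of "{..<d} \<times> {..<2*m}" "\<lambda>_. {..<2*m}"]]) auto

lemma finite_labellings [simp]: "finite labellings"
  by (simp add: labellings_def finite_PiE)

lemma finite_assignments [simp]: "finite assignments"
  by (simp add: assignments_def finite_PiE)

lemma matchings_nonempty: "matchings \<noteq> {}"
proof -
  have "restrict (\<lambda>(j, v). if v < m then v + m else v - m) ({..<d} \<times> {..<2*m}) \<in> matchings"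
    by (auto simp: matchings_def)
  then show ?thesis by blast
qed

lemma labellings_nonempty: "labellings \<noteq> {}"
  by (simp add: labellings_def PiE_eq_empty_iff)

lemma assignments_nonempty: "assignments \<noteq> {}"
  by (simp add: assignments_def PiE_eq_empty_iff)

lemma edge_key_in_edges:
  assumes "\<sigma> \<in> matchings" "j < d" "v < 2*m"
  shows "edge_key v j (\<sigma> (j, v)) \<in> edges"
  using assms matchings_side[OF assms] by (auto simp: edge_key_def edges_def)

lemma csp_oracle_labelled_graph:
  assumes \<sigma>: "\<sigma> \<in> matchings"
  shows "csp_oracle (labelled_graph \<sigma> u) x i =
    (if x < 2*m \<and> 1 \<le> i \<and> i \<le> d
     then Some (let v = (if x < m then x else \<sigma> (i - 1, x)) in
       ((v, if x < m then \<sigma> (i - 1, x) else x), (False, u (edge_key x (i - 1) (\<sigma> (i - 1, x))))))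
     else None)"
proof (cases "x < 2*m \<and> 1 \<le> i \<and> i \<le> d")
  case True
  then obtain j where i: "i = Suc j" and j: "j < d" by (cases i) auto
  let ?v = "if x < m then x else \<sigma> (j, x)"
  have v: "?v < m" using matchings_side[OF \<sigma> j, of x] True by auto
  have lt: "j * m + ?v < d * m"
  proof -
    have "j * m + ?v < Suc j * m" using v by simp
    also have "\<dots> \<le> d * m" using j by (intro mult_le_mono1) simp
    finally show ?thesis .
  qed
  have dm: "(j * m + ?v) div m = j" "(j * m + ?v) mod m = ?v" using v by auto
  have inc: "incident (labelled_graph \<sigma> u) x ! j = j * m + ?v"
    using True j by (simp add: labelled_graph_def)
  have "constraints (labelled_graph \<sigma> u) ! (j * m + ?v) = ((?v, \<sigma> (j, ?v)), (False, u (j, ?v)))"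
    using lt dm by (simp add: labelled_graph_def del: if_split)
  moreover have "length (incident (labelled_graph \<sigma> u) x) = d"
    using True by (simp add: labelled_graph_def)
  ultimately show ?thesis
    using True i j inc matchings_involution[OF \<sigma> j, of x]
    by (auto simp: csp_oracle_def edge_key_def Let_def)
next
  case False
  then show ?thesis by (auto simp: csp_oracle_def labelled_graph_def)
qed

lemma labelled_graph_bounded_degree:
  assumes \<sigma>: "\<sigma> \<in> matchings" and n: "2*m \<le> n"
  shows "labelled_graph \<sigma> u \<in> bounded_degree_instances n d"
proof -
  let ?I = "labelled_graph \<sigma> u"
  have len: "length (constraints ?I) = d * m" by (simp add: labelled_graph_def)
  have nth: "constraints ?I ! k = ((k mod m, \<sigma> (k div m, k mod m)), (False, u (k div m, k mod m)))"
    if "k < d * m" for k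
    using that by (simp add: labelled_graph_def)
  have km: "k div m < d \<and> k mod m < m" if "k < d * m" for k
  proof -
    have "m > 0" using that by (cases m) auto
    then show ?thesis using that by (simp add: less_mult_imp_div_less)
  qed
  have "\<forall>((x, y), b) \<in> set (constraints ?I). x < n \<and> y < n \<and> x \<noteq> y"
  proof -
    have "x < n \<and> y < n \<and> x \<noteq> y" if c: "((x, y), b) \<in> set (constraints ?I)" for x y b
    proof -
      obtain k where k: "k < d * m" and xy: "x = k mod m" "y = \<sigma> (k div m, k mod m)"
        using c by (auto simp: in_set_conv_nth len nth)
      obtain i a where "k div m = i" "k mod m = a" "i < d" "a < m" using km[OF k] by blast
      then show ?thesis using xy n matchings_lt[OF \<sigma>, of i a] matchings_side[OF \<sigma>, of i a] by auto
    qed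
    then show ?thesis by auto
  qed
  moreover have "distinct (incident ?I x) \<and>
      set (incident ?I x) = {j. j < length (constraints ?I) \<and> x \<in> constraint_vars (constraints ?I ! j)} \<and>
      length (incident ?I x) \<le> d" for x
  proof (cases "x < 2*m")
    case False
    have "x \<notin> constraint_vars (constraints ?I ! k)" if k: "k < d * m" for k
    proof -
      obtain i a where "k div m = i" "k mod m = a" "i < d" "a < m" using km[OF k] by blast
      then show ?thesis using False matchings_lt[OF \<sigma>, of i a] by (auto simp: nth[OF k])
    qed
    with False show ?thesis by (auto simp: len) (auto simp: labelled_graph_def)
  next
    case True
    define v where "v j = (if x < m then x else \<sigma> (j, x))" for j
    have v: "v j < m" if "j < d" for j using matchings_side[OF \<sigma> that True] by (auto simp: v_def)
    have inc: "incident ?I x = map (\<lambda>j. j * m + v j) [0..<d]"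
      using True by (simp add: labelled_graph_def v_def)
    have dv: "(j * m + v j) div m = j" "(j * m + v j) mod m = v j" if "j < d" for j
      using v[OF that] by auto
    have "inj_on (\<lambda>j. j * m + v j) {0..<d}"
      by (rule inj_on_inverseI[where g = "\<lambda>k. k div m"]) (use dv in auto)
    then have "distinct (incident ?I x)" by (simp add: inc distinct_map)
    moreover have "set (incident ?I x) = {k. k < d * m \<and> x \<in> constraint_vars (constraints ?I ! k)}"
    proof (intro subset_antisym subsetI)
      fix k assume "k \<in> set (incident ?I x)"
      then obtain j where j: "j < d" "k = j * m + v j" by (auto simp: inc)
      have "k < Suc j * m" using v[OF j(1)] j by simp
      also have "\<dots> \<le> d * m" using j by (intro mult_le_mono1) simp
      finally have k: "k < d * m" .
      have "x = v j \<or> x = \<sigma> (j, v j)"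
        using matchings_involution[OF \<sigma> j(1) True] by (auto simp: v_def)
      then show "k \<in> {k. k < d * m \<and> x \<in> constraint_vars (constraints ?I ! k)}"
        using k dv[OF j(1)] nth[OF k] by (auto simp: j(2))
    next
      fix k assume "k \<in> {k. k < d * m \<and> x \<in> constraint_vars (constraints ?I ! k)}"
      then have k: "k < d * m" and x: "x = k mod m \<or> x = \<sigma> (k div m, k mod m)" by (auto simp: nth)
      have kd: "k div m < d" "k mod m < m" using km[OF k] by auto
      then obtain i a where ia: "k div m = i" "k mod m = a" "i < d" "a < m" by blast
      then have "v (k div m) = k mod m"
        using x matchings_side[OF \<sigma>, of i a] matchings_involution[OF \<sigma>, of i a]
        by (auto simp: v_def)
      then have "k = k div m * m + v (k div m)" by simp
      then show "k \<in> set (incident ?I x)" using kd by (auto simp: inc)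
    qed
    ultimately show ?thesis using inc len by simp
  qed
  ultimately show ?thesis by (simp add: bounded_degree_instances_def)
qed

subsection \<open>Planted labels along an exploration\<close>

definition adj :: "edge set \<Rightarrow> history \<Rightarrow> (nat \<times> nat) set" where
  "adj g h = {(v, y). \<exists>j. (v, j, y) \<in> set h \<and> edge_key v j y \<in> g \<or>
     (y, j, v) \<in> set h \<and> edge_key y j v \<in> g}"

primrec consistent :: "(nat \<times> nat \<Rightarrow> nat) \<Rightarrow> history \<Rightarrow> bool" where
  "consistent \<sigma> [] \<longleftrightarrow> True"
| "consistent \<sigma> (q # h) \<longleftrightarrow> consistent \<sigma> h \<and>
     (case q of (v, j, y) \<Rightarrow> j < d \<and> v < 2*m \<and> v \<notin> touched h j \<and> y = \<sigma> (j, v))"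

definition keys :: "history \<Rightarrow> edge set" where
  "keys h = (\<lambda>(v, j, y). edge_key v j y) ` set h"

text \<open>Each edge is tested against the older ones only, at the moment it is revealed. Since
  \<open>adj\<close> forgets the matching, two parallel good edges already count as a cycle.\<close>

primrec cyclic :: "edge set \<Rightarrow> history \<Rightarrow> bool" where
  "cyclic g [] \<longleftrightarrow> False"
| "cyclic g (q # h) \<longleftrightarrow> cyclic g h \<or>
     (case q of (v, j, y) \<Rightarrow> edge_key v j y \<in> g \<and> (v, y) \<in> (adj g h)\<^sup>*)"

text \<open>The labelling \<open>u\<close> supplies the uniform labels of the bad edges, so a
  planted labelling is a function of a uniform pair \<open>(s, u)\<close> and its distribution can
  be studied by counting pairs.\<close>

definition planted :: "(nat \<times> nat \<Rightarrow> nat) \<Rightarrow> edge set \<Rightarrow> (nat \<Rightarrow> bool) \<Rightarrow> (edge \<Rightarrow> bool) \<Rightarrow> edge \<Rightarrow> bool" where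
  "planted \<sigma> g s u = restrict (\<lambda>(j, a). if (j, a) \<in> g then s a = s (\<sigma> (j, a)) else u (j, a)) edges"

lemma keys_Nil [simp]: "keys [] = {}"
  by (simp add: keys_def)

lemma keys_Cons [simp]: "keys ((v, j, y) # h) = insert (edge_key v j y) (keys h)"
  by (simp add: keys_def)

lemma keysE:
  assumes "e \<in> keys h"
  obtains v j y where "(v, j, y) \<in> set h" "e = edge_key v j y"
proof -
  from assms obtain q where q: "q \<in> set h" "e = (\<lambda>(v, j, y). edge_key v j y) q"
    unfolding keys_def by blast
  obtain v j y where "q = (v, j, y)" by (cases q)
  with q show thesis using that[of v j y] by simp
qed

lemma touched_Nil [simp]: "touched [] j = {}"
  by (simp add: touched_def)

lemma consistent_entry:
  assumes "consistent \<sigma> h" "(v, j, y) \<in> set h"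
  shows "j < d" "v < 2*m" "y = \<sigma> (j, v)"
  using assms by (induction h) auto

text \<open>Freshness of a query is tested on vertices, while labels and marks live on edges. The
  two views agree because a recorded edge touches both of its ends.\<close>

lemma touched_edge_key:
  assumes \<sigma>: "\<sigma> \<in> matchings" and h: "consistent \<sigma> h" and j: "j < d" and v: "v < 2*m"
  shows "v \<in> touched h j \<longleftrightarrow> edge_key v j (\<sigma> (j, v)) \<in> keys h"
proof
  assume "v \<in> touched h j"
  then obtain y where "(v, j, y) \<in> set h \<or> (y, j, v) \<in> set h" by (auto simp: touched_def)
  then show "edge_key v j (\<sigma> (j, v)) \<in> keys h"
  proof
    assume a: "(v, j, y) \<in> set h"
    then show ?thesis using consistent_entry[OF h a] by (force simp: keys_def)
  next
    assume a: "(y, j, v) \<in> set h"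
    note e = consistent_entry[OF h a]
    have "edge_key y j v = edge_key v j (\<sigma> (j, v))"
      using e matchings_side[OF \<sigma> j, of y] matchings_involution[OF \<sigma> j, of y] by (auto simp: edge_key_def)
    then show ?thesis using a by (force simp: keys_def)
  qed
next
  assume "edge_key v j (\<sigma> (j, v)) \<in> keys h"
  then obtain v' y where a: "(v', j, y) \<in> set h" and k: "edge_key v j (\<sigma> (j, v)) = edge_key v' j y"
    by (auto simp: keys_def edge_key_def)
  note e = consistent_entry[OF h a]
  have "v = v' \<or> v = y"
    using k e(3) matchings_involution[OF \<sigma> j v] matchings_involution[OF \<sigma> j e(2)]
    unfolding edge_key_def by (metis prod.inject)
  then show "v \<in> touched h j" using a by (auto simp: touched_def)
qed

lemma planted_edge_key:
  assumes \<sigma>: "\<sigma> \<in> matchings" and j: "j < d" and v: "v < 2*m"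
  shows "planted \<sigma> g s u (edge_key v j (\<sigma> (j, v))) =
    (if edge_key v j (\<sigma> (j, v)) \<in> g then s v = s (\<sigma> (j, v)) else u (edge_key v j (\<sigma> (j, v))))"
  using edge_key_in_edges[OF \<sigma> j v] matchings_involution[OF \<sigma> j v]
  by (auto simp: planted_def edge_key_def)

lemma planted_in_labellings: "planted \<sigma> g s u \<in> labellings"
  by (simp add: planted_def labellings_def)

text \<open>Flipping the label of the fresh edge \<open>e\<close> is an involution that leaves the
  labels on \<open>K\<close> alone.\<close>

lemma card_agreeing_labellings_Cons:
  assumes "e \<in> edges" "e \<notin> K"
  shows "2 * card {u \<in> labellings. \<forall>e'\<in>insert e K. u e' = c e'} = card {u \<in> labellings. \<forall>e'\<in>K. u e' = c e'}"
proof -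
  let ?P = "{u \<in> labellings. \<forall>e'\<in>K. u e' = c e'}"
  have "2 * card {u \<in> ?P. u e = c e} = card ?P"
  proof (rule card_half[where f = "\<lambda>u. u(e := \<not> u e)"])
    fix u assume "u \<in> ?P"
    then show "u(e := \<not> u e) \<in> ?P \<and> (u(e := \<not> u e))(e := \<not> (u(e := \<not> u e)) e) = u \<and>
        ((u(e := \<not> u e)) e \<longleftrightarrow> \<not> u e)"
      using assms by (auto simp: labellings_def PiE_def extensional_def)
  qed simp
  then show ?thesis by (simp add: conj_ac)
qed

text \<open>If the new edge is good and its endpoints are not yet connected by good edges, flipping
  the planted assignment on one of the two good components flips exactly the new label.\<close>

lemma card_agreeing_planted_Cons:
  assumes \<sigma>: "\<sigma> \<in> matchings" and h: "consistent \<sigma> ((v, j, y) # h)" and nc: "\<not> cyclic g ((v, j, y) # h)"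
  shows "2 * card {(s, u) \<in> assignments \<times> labellings. \<forall>e\<in>keys ((v, j, y) # h). planted \<sigma> g s u e = c e}
    = card {(s, u) \<in> assignments \<times> labellings. \<forall>e\<in>keys h. planted \<sigma> g s u e = c e}"
proof -
  let ?P = "{(s, u) \<in> assignments \<times> labellings. \<forall>e\<in>keys h. planted \<sigma> g s u e = c e}"
  let ?e = "edge_key v j y"
  have jv: "j < d" "v < 2*m" "y = \<sigma> (j, v)" and hh: "consistent \<sigma> h" and vt: "v \<notin> touched h j"
    using h by auto
  have e: "?e \<in> edges" "?e \<notin> keys h"
    using edge_key_in_edges[OF \<sigma> jv(1,2)] touched_edge_key[OF \<sigma> hh jv(1,2)] vt jv(3) by auto
  have y: "y < 2*m" using matchings_lt[OF \<sigma> jv(1,2)] jv by simp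
  have "finite ?P"
    by (rule finite_subset[of _ "assignments \<times> labellings"]) auto
  have "2 * card {p \<in> ?P. planted \<sigma> g (fst p) (snd p) ?e = c ?e} = card ?P"
  proof (cases "?e \<in> g")
    case False
    let ?f = "\<lambda>(s, u). (s, u(?e := \<not> u ?e)) :: (nat \<Rightarrow> bool) \<times> (edge \<Rightarrow> bool)"
    have pl: "planted \<sigma> g s (u(?e := \<not> u ?e)) e' = (if e' = ?e then \<not> u ?e else planted \<sigma> g s u e')" for s u e'
      using False e(1) by (auto simp: planted_def restrict_def)
    show ?thesis
    proof (rule card_half[where f = ?f])
      fix p assume p: "p \<in> ?P"
      obtain s u where su: "p = (s, u)" by (cases p)
      have "u(?e := \<not> u ?e) \<in> labellings"
        using p e(1) by (auto simp: su labellings_def PiE_def extensional_def)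
      moreover have "planted \<sigma> g s (u(?e := \<not> u ?e)) e' = planted \<sigma> g s u e'" if "e' \<in> keys h" for e'
        using e(2) that by (subst pl) auto
      moreover have "planted \<sigma> g s u ?e = u ?e" for u
        using planted_edge_key[OF \<sigma> jv(1,2), of g s u] False unfolding jv(3)[symmetric] by simp
      ultimately show "?f p \<in> ?P \<and> ?f (?f p) = p \<and>
          (planted \<sigma> g (fst (?f p)) (snd (?f p)) ?e \<longleftrightarrow> \<not> planted \<sigma> g (fst p) (snd p) ?e)"
        using p by (auto simp: su)
    qed fact
  next
    case True
    define C where "C = {z. (v, z) \<in> (adj g h)\<^sup>*}"
    have vC: "v \<in> C" and yC: "y \<notin> C" using nc True by (auto simp: C_def)
    have C: "a \<in> C \<longleftrightarrow> b \<in> C" if "(a, i, b) \<in> set h" "edge_key a i b \<in> g" for a i b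
    proof -
      have "(a, b) \<in> adj g h" "(b, a) \<in> adj g h" using that by (auto simp: adj_def)
      then show ?thesis by (auto simp: C_def intro: rtrancl_into_rtrancl)
    qed
    let ?s = "\<lambda>s. restrict (\<lambda>x. s x \<noteq> (x \<in> C)) {..<2*m}"
    let ?f = "\<lambda>(s, u). (?s s, u) :: (nat \<Rightarrow> bool) \<times> (edge \<Rightarrow> bool)"
    have pl: "planted \<sigma> g (?s s) u e' = planted \<sigma> g s u e'" if "e' \<in> keys h" for s u e'
    proof -
      from that obtain a i b where ab: "(a, i, b) \<in> set h" "e' = edge_key a i b"
        by (rule keysE)
      note en = consistent_entry[OF hh ab(1)]
      have "b < 2*m" using matchings_lt[OF \<sigma> en(1,2)] en by simp
      moreover have "planted \<sigma> g s u e' = (if e' \<in> g then s a = s b else u e')" for s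
        using planted_edge_key[OF \<sigma> en(1,2), of g s u] unfolding en(3)[symmetric] ab(2) .
      ultimately show ?thesis
        using en(2) C[OF ab(1)] unfolding ab(2) by auto
    qed
    have ple: "planted \<sigma> g (?s s) u ?e \<longleftrightarrow> \<not> planted \<sigma> g s u ?e" for s u
      using planted_edge_key[OF \<sigma> jv(1,2), of g] jv y vC yC True by auto
    have ss: "?s (?s s) = s" "?s s \<in> assignments" if "s \<in> assignments" for s
      using that by (auto simp: assignments_def PiE_def extensional_def restrict_def fun_eq_iff)
    show ?thesis
    proof (rule card_half[where f = ?f])
      fix p assume p: "p \<in> ?P"
      obtain s u where su: "p = (s, u)" by (cases p)
      have "?f p \<in> ?P" using p ss pl by (auto simp: su)
      moreover have "?f (?f p) = p" using p ss by (simp add: su)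
      moreover have "planted \<sigma> g (fst (?f p)) (snd (?f p)) ?e \<longleftrightarrow> \<not> planted \<sigma> g (fst p) (snd p) ?e"
        using ple by (simp add: su)
      ultimately show "?f p \<in> ?P \<and> ?f (?f p) = p \<and>
          (planted \<sigma> g (fst (?f p)) (snd (?f p)) ?e \<longleftrightarrow> \<not> planted \<sigma> g (fst p) (snd p) ?e)" by blast
    qed fact
  qed
  moreover have "{p \<in> ?P. planted \<sigma> g (fst p) (snd p) ?e = c ?e} =
    {(s, u) \<in> assignments \<times> labellings. \<forall>e\<in>keys ((v, j, y) # h). planted \<sigma> g s u e = c e}"
    by auto
  ultimately show ?thesis by simp
qed

lemma card_assignments: "card assignments = 2 ^ (2*m)"
  by (simp add: assignments_def card_PiE)

text \<open>Every entry of an acyclic history halves the count in both models, and with an empty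
  history all pairs are counted. Hence each pattern \<open>c\<close> of labels on the explored edges
  is equally likely under planted and under uniform labels.\<close>

lemma card_agreeing_planted:
  assumes \<sigma>: "\<sigma> \<in> matchings" and "consistent \<sigma> h" "\<not> cyclic g h"
  shows "card {(s, u) \<in> assignments \<times> labellings. \<forall>e\<in>keys h. planted \<sigma> g s u e = c e}
    = card assignments * card {u \<in> labellings. \<forall>e\<in>keys h. u e = c e}"
  using assms(2,3)
proof (induction h)
  case Nil
  have "{(s, u). s \<in> assignments \<and> u \<in> labellings} = assignments \<times> labellings" by auto
  then show ?case by (simp add: card_cartesian_product)
next
  case (Cons q h)
  obtain v j y where q: "q = (v, j, y)" by (cases q)
  have jv: "j < d" "v < 2*m" "y = \<sigma> (j, v)" and hh: "consistent \<sigma> h" and vt: "v \<notin> touched h j"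
    using Cons.prems by (auto simp: q)
  have e: "edge_key v j y \<in> edges" "edge_key v j y \<notin> keys h"
    using edge_key_in_edges[OF \<sigma> jv(1,2)] touched_edge_key[OF \<sigma> hh jv(1,2)] vt jv(3) by auto
  have a: "2 * card {(s, u) \<in> assignments \<times> labellings. \<forall>e\<in>keys (q # h). planted \<sigma> g s u e = c e}
      = card {(s, u) \<in> assignments \<times> labellings. \<forall>e\<in>keys h. planted \<sigma> g s u e = c e}"
    using card_agreeing_planted_Cons[OF \<sigma>] Cons.prems unfolding q by blast
  have b: "2 * card {u \<in> labellings. \<forall>e\<in>keys (q # h). u e = c e} = card {u \<in> labellings. \<forall>e\<in>keys h. u e = c e}"
    using card_agreeing_labellings_Cons[OF e] unfolding q keys_Cons .
  have c: "card {(s, u) \<in> assignments \<times> labellings. \<forall>e\<in>keys h. planted \<sigma> g s u e = c e}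
    = card assignments * card {u \<in> labellings. \<forall>e\<in>keys h. u e = c e}"
    using Cons.IH Cons.prems by simp
  have "x = k * y" if "2 * x = x'" "2 * y = y'" "x' = k * y'" for x x' y y' k :: nat
    using that by auto
  from this[OF a b c] show ?case .
qed

lemma set_explore: "set h \<subseteq> set (explore \<sigma> u t h)"
  by (induction t arbitrary: h) (force split: if_splits)+

lemma keys_explore: "keys h \<subseteq> keys (explore \<sigma> u t h)"
  unfolding keys_def using set_explore by (rule image_mono)

lemma explore_consistent:
  "consistent \<sigma> h \<Longrightarrow> consistent \<sigma> (explore \<sigma> u t h)"
proof (induction t arbitrary: h)
  case (Query x i f)
  show ?case using Query.prems by (auto intro!: Query.IH)
qed simp

lemma length_explore:
  "length (explore \<sigma> u t h) \<le> length h + num_queries (labelled_graph \<sigma> u) t"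
proof (induction t arbitrary: h)
  case (Query x i f)
  show ?case by (auto intro: order_trans[OF Query.IH])
qed simp

text \<open>The tree sees labels only through its answers, and each answer carries the label of an
  edge that is recorded by then. Changing labels elsewhere therefore cannot change the run.\<close>

lemma explore_local:
  assumes \<sigma>: "\<sigma> \<in> matchings" and "consistent \<sigma> h"
    and "\<forall>e\<in>keys (explore \<sigma> u t h). u' e = u e"
  shows "explore \<sigma> u' t h = explore \<sigma> u t h \<and>
    accepts (labelled_graph \<sigma> u') t = accepts (labelled_graph \<sigma> u) t"
  using assms(2,3)
proof (induction t arbitrary: h)
  case (Query x i f)
  let ?h = "if x < 2*m \<and> 1 \<le> i \<and> i \<le> d \<and> x \<notin> touched h (i - 1) then (x, i - 1, \<sigma> (i - 1, x)) # h else h"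
  let ?a = "\<lambda>u. csp_oracle (labelled_graph \<sigma> u) x i"
  have c: "consistent \<sigma> ?h" using Query.prems by auto
  have "edge_key x (i - 1) (\<sigma> (i - 1, x)) \<in> keys ?h" if "x < 2*m \<and> 1 \<le> i \<and> i \<le> d"
    using that touched_edge_key[OF \<sigma> Query.prems(1), of "i - 1" x] by auto
  then have "u' (edge_key x (i - 1) (\<sigma> (i - 1, x))) = u (edge_key x (i - 1) (\<sigma> (i - 1, x)))"
    if "x < 2*m \<and> 1 \<le> i \<and> i \<le> d"
    using that Query.prems(2) keys_explore[of ?h \<sigma> u "f (?a u)"] by auto
  then have a: "?a u' = ?a u" by (auto simp: csp_oracle_labelled_graph[OF \<sigma>])
  have "\<forall>e\<in>keys (explore \<sigma> u (f (?a u)) ?h). u' e = u e"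
    using Query.prems(2) by simp
  from Query.IH[OF _ c this] show ?case by (simp only: explore.simps accepts.simps a) simp
qed simp

text \<open>Labellings are grouped by what the run sees. By \<open>explore_local\<close> a group
  lies inside \<open>?L\<close> or is disjoint from it, and by \<open>card_agreeing_planted\<close>
  each group inside has the same weight in both models. Dropping the cyclic runs leaves an
  inequality.\<close>

lemma reject_planted:
  assumes \<sigma>: "\<sigma> \<in> matchings"
  shows "card assignments * card {u \<in> labellings. \<not> accepts (labelled_graph \<sigma> u) t \<and> \<not> cyclic g (explore \<sigma> u t [])}
    \<le> card {(s, u) \<in> assignments \<times> labellings. \<not> accepts (labelled_graph \<sigma> (planted \<sigma> g s u)) t}"
proof -
  let ?L = "{u \<in> labellings. \<not> accepts (labelled_graph \<sigma> u) t \<and> \<not> cyclic g (explore \<sigma> u t [])}"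
  let ?R = "{(s, u) \<in> assignments \<times> labellings. \<not> accepts (labelled_graph \<sigma> (planted \<sigma> g s u)) t}"
  \<comment> \<open>\<open>cyl u\<close> plays the part of the leaf reached by \<open>u\<close>: all
    labellings with the same transcript. \<open>pre\<close> pulls a set of labellings back along
    \<open>planted\<close>.\<close>
  define cyl where "cyl u = {u' \<in> labellings. \<forall>e\<in>keys (explore \<sigma> u t []). u' e = u e}" for u
  define pre where "pre X = {(s, u) \<in> assignments \<times> labellings. planted \<sigma> g s u \<in> X}" for X
  have loc: "explore \<sigma> u' t [] = explore \<sigma> u t []"
    "accepts (labelled_graph \<sigma> u') t = accepts (labelled_graph \<sigma> u) t"  if "u' \<in> cyl u" for u u'
    using explore_local[OF \<sigma>, of "[]" u t u'] that by (auto simp: cyl_def)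
  have cyl_eq: "cyl u' = cyl u" if "u' \<in> cyl u" for u u'
    using loc(1)[OF that] that by (auto simp: cyl_def)
  have sub: "X \<subseteq> ?L" if "X \<in> cyl ` ?L" for X
  proof
    fix u' assume u': "u' \<in> X"
    from that obtain u where u: "u \<in> ?L" "X = cyl u" by (rule imageE)
    then have "u' \<in> cyl u" using u' by simp
    from loc[OF this] this u(1) show "u' \<in> ?L" by (simp add: cyl_def)
  qed
  have Un: "\<Union> (cyl ` ?L) = ?L"
    using sub by (auto simp: cyl_def)
  have disj: "X \<inter> Y = {}" if "X \<in> cyl ` ?L" "Y \<in> cyl ` ?L" "X \<noteq> Y" for X Y
  proof (rule ccontr)
    assume "X \<inter> Y \<noteq> {}"
    then obtain w where "w \<in> X" "w \<in> Y" by blast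
    moreover from that(1) obtain a where "X = cyl a" by blast
    moreover from that(2) obtain b where "Y = cyl b" by blast
    ultimately show False using cyl_eq[of w a] cyl_eq[of w b] that(3) by simp
  qed
  have fin: "finite (cyl ` ?L)" by simp
  have finL: "finite ?L" by simp
  have "card (\<Union> (cyl ` ?L)) = (\<Sum>X\<in>cyl ` ?L. card X)"
  proof (rule card_Union_disjoint)
    show "pairwise disjnt (cyl ` ?L)" using disj unfolding pairwise_def disjnt_def by blast
    show "finite X" if "X \<in> cyl ` ?L" for X using sub[OF that] finL by (rule finite_subset)
  qed
  then have "card ?L = (\<Sum>X\<in>cyl ` ?L. card X)" unfolding Un .
  then have "card assignments * card ?L = (\<Sum>X\<in>cyl ` ?L. card assignments * card X)"
    by (simp add: sum_distrib_left)
  also have "\<dots> = (\<Sum>X\<in>cyl ` ?L. card (pre X))"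
  proof (rule sum.cong[OF refl])
    fix X assume "X \<in> cyl ` ?L"
    then obtain u0 where u0: "u0 \<in> ?L" "X = cyl u0" by auto
    have "pre X = {(s, u) \<in> assignments \<times> labellings. \<forall>e\<in>keys (explore \<sigma> u0 t []). planted \<sigma> g s u e = u0 e}"
      using planted_in_labellings by (simp add: pre_def u0(2) cyl_def)
    then show "card assignments * card X = card (pre X)"
      using card_agreeing_planted[OF \<sigma> explore_consistent, of "[]" g u0 t u0] u0
      by (simp add: cyl_def)
  qed
  also have "\<dots> = card (\<Union>X\<in>cyl ` ?L. pre X)"
  proof (rule card_UN_disjoint[symmetric, OF fin])
    show "\<forall>X\<in>cyl ` ?L. finite (pre X)"
      by (auto simp: pre_def intro: finite_subset[of _ "assignments \<times> labellings"])
    show "\<forall>X\<in>cyl ` ?L. \<forall>Y\<in>cyl ` ?L. X \<noteq> Y \<longrightarrow> pre X \<inter> pre Y = {}"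
      using disj by (fastforce simp: pre_def)
  qed
  also have "\<dots> \<le> card ?R"
  proof (rule card_mono)
    show "finite ?R" by (auto intro: finite_subset[of _ "assignments \<times> labellings"])
    have "pre X \<subseteq> ?R" if "X \<in> cyl ` ?L" for X using sub[OF that] by (auto simp: pre_def)
    then show "(\<Union>X\<in>cyl ` ?L. pre X) \<subseteq> ?R" by blast
  qed
  finally show ?thesis .
qed

subsection \<open>Good components of the explored graph\<close>

primrec vertices :: "history \<Rightarrow> nat set" where
  "vertices [] = {}"
| "vertices (q # h) = (case q of (v, j, y) \<Rightarrow> {v, y}) \<union> vertices h"

text \<open>Only an answer never seen before receives a parent, and it keeps it. As the two ends of
  an edge differ, the pointers form a forest.\<close>

primrec parent :: "history \<Rightarrow> nat \<Rightarrow> (nat \<times> nat) option" where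
  "parent [] = Map.empty"
| "parent (q # h) = (case q of (v, j, y) \<Rightarrow> if y \<in> vertices h then parent h else (parent h)(y \<mapsto> (v, j)))"

text \<open>Both ends are kept because a path of good edges may cross a surplus edge in either
  direction.\<close>

primrec surplus_ends :: "history \<Rightarrow> nat set" where
  "surplus_ends [] = {}"
| "surplus_ends (q # h) = (case q of (v, j, y) \<Rightarrow> if y \<in> vertices h then {v, y} else {}) \<union> surplus_ends h"

primrec climb :: "edge set \<Rightarrow> history \<Rightarrow> nat \<Rightarrow> nat \<Rightarrow> nat \<Rightarrow> bool" where
  "climb g h 0 y z \<longleftrightarrow> y = z"
| "climb g h (Suc b) y z \<longleftrightarrow> (\<exists>p j. parent h y = Some (p, j) \<and> edge_key p j y \<in> g \<and> climb g h b p z)"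

definition deep :: "edge set \<Rightarrow> history \<Rightarrow> nat \<Rightarrow> nat \<Rightarrow> bool" where
  "deep g h r y \<longleftrightarrow> (\<exists>z. climb g h r y z)"

definition near :: "nat \<Rightarrow> edge set \<Rightarrow> history \<Rightarrow> nat \<Rightarrow> nat set" where
  "near r g h v = {y. \<exists>w\<in>insert v (surplus_ends h). \<exists>a<r. \<exists>b<r. \<exists>z. climb g h a w z \<and> climb g h b y z}"

text \<open>This overestimates the good component of \<open>v\<close> by something easy to count.
  Every surplus end is treated as if it were connected to \<open>v\<close>, and as soon as one of
  these starting points is deep, all visited vertices are included.\<close>

definition danger :: "nat \<Rightarrow> edge set \<Rightarrow> history \<Rightarrow> nat \<Rightarrow> nat set" where
  "danger r g h v = near r g h v \<union>
     {y \<in> insert v (vertices h). deep g h r y \<or> (\<exists>w\<in>insert v (surplus_ends h). deep g h r w)}"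

lemma finite_vertices [simp]: "finite (vertices h)"
  by (induction h) auto

lemma finite_surplus_ends [simp]: "finite (surplus_ends h)"
  by (induction h) auto

lemma card_vertices: "card (vertices h) \<le> 2 * length h"
proof (induction h)
  case (Cons q h)
  obtain v j y where q: "q = (v, j, y)" by (cases q)
  have "card (vertices (q # h)) \<le> card {v, y} + card (vertices h)"
    by (simp only: vertices.simps q prod.case card_Un_le)
  also have "card {v, y} \<le> 2" by (simp add: card_insert_if)
  finally show ?case using Cons.IH by simp
qed simp

lemma entry_in_vertices: "(v, j, y) \<in> set h \<Longrightarrow> v \<in> vertices h \<and> y \<in> vertices h"
  by (induction h) auto

lemma parent_entry: "parent h y = Some (p, j) \<Longrightarrow> (p, j, y) \<in> set h"
  by (induction h) (auto split: if_splits)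

lemma parent_None: "y \<notin> vertices h \<Longrightarrow> parent h y = None"
  by (metis entry_in_vertices not_None_eq parent_entry surj_pair)

lemma parent_Cons: "parent h y = Some pj \<Longrightarrow> parent (q # h) y = Some pj"
  using parent_None[of y h] by (cases q) auto

lemma entry_parent_or_surplus:
  "(p, j, c) \<in> set h \<Longrightarrow> parent h c = Some (p, j) \<or> {p, c} \<subseteq> surplus_ends h"
proof (induction h)
  case (Cons q h)
  then consider "q = (p, j, c)" | "(p, j, c) \<in> set h" by auto
  then show ?case
  proof cases
    case 2
    then show ?thesis using Cons.IH parent_Cons by fastforce
  qed auto
qed simp

lemma climb_Suc_right:
  "climb g h b y p \<Longrightarrow> parent h p = Some (z, j) \<Longrightarrow> edge_key z j p \<in> g \<Longrightarrow> climb g h (Suc b) y z"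
  by (induction b arbitrary: y) auto

lemma climb_prefix: "climb g h b y z \<Longrightarrow> r \<le> b \<Longrightarrow> deep g h r y"
proof (induction b arbitrary: y r)
  case (Suc b)
  then show ?case by (cases r) (fastforce simp: deep_def)+
qed (simp add: deep_def)

lemma climb_unique: "climb g h b y z \<Longrightarrow> climb g h b y z' \<Longrightarrow> z = z'"
  by (induction b arbitrary: y) auto

text \<open>Along a path of good edges the last surplus edge is followed by tree edges only, and in a
  forest two connected vertices have a common ancestor.\<close>

lemma connected_common_ancestor:
  assumes "(v, y) \<in> (adj g h)\<^sup>*"
  shows "y \<in> insert v (vertices h) \<and>
    (\<exists>w\<in>insert v (surplus_ends h). \<exists>a b z. climb g h a w z \<and> climb g h b y z)"
  using assms
proof (induction rule: rtrancl_induct)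
  case base
  have "climb g h 0 v v" by simp
  then show ?case by blast
next
  case (step y y')
  then obtain w a b z where w: "w \<in> insert v (surplus_ends h)" and a: "climb g h a w z" and b: "climb g h b y z"
    by blast
  from step.hyps(2) obtain j where
    "(y, j, y') \<in> set h \<and> edge_key y j y' \<in> g \<or> (y', j, y) \<in> set h \<and> edge_key y' j y \<in> g"
    by (auto simp: adj_def)
  then show ?case
  proof
    assume e: "(y, j, y') \<in> set h \<and> edge_key y j y' \<in> g"
    then consider "parent h y' = Some (y, j)" | "y' \<in> surplus_ends h"
      using entry_parent_or_surplus by fastforce
    then show ?thesis
    proof cases
      case 1
      then have "climb g h (Suc b) y' z" using b e by auto
      then show ?thesis using w a e entry_in_vertices by blast
    next
      case 2
      have "climb g h 0 y' y'" by simp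
      then show ?thesis using 2 e entry_in_vertices by blast
    qed
  next
    assume e: "(y', j, y) \<in> set h \<and> edge_key y' j y \<in> g"
    then consider "parent h y = Some (y', j)" | "y' \<in> surplus_ends h"
      using entry_parent_or_surplus by fastforce
    then show ?thesis
    proof cases
      case 1
      have "\<exists>a b z. climb g h a w z \<and> climb g h b y' z"
      proof (cases b)
        case 0
        then have "climb g h (Suc a) w y'" using a b 1 e climb_Suc_right by auto
        moreover have "climb g h 0 y' y'" by simp
        ultimately show ?thesis by blast
      next
        case (Suc b')
        then have "climb g h b' y' z" using b 1 by auto
        then show ?thesis using a by blast
      qed
      then show ?thesis using w e entry_in_vertices by blast
    next
      case 2
      have "climb g h 0 y' y'" by simp
      then show ?thesis using 2 e entry_in_vertices by blast
    qed
  qed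
qed

text \<open>Either both climbs to the common ancestor are shorter than \<open>r\<close>, which is
  the \<open>near\<close> part, or one of them has a prefix of length \<open>r\<close> and its lower
  end is \<open>deep\<close>.\<close>

lemma connected_in_danger:
  assumes "(v, y) \<in> (adj g h)\<^sup>*"
  shows "y \<in> danger r g h v"
proof -
  obtain w a b z where w: "w \<in> insert v (surplus_ends h)" and a: "climb g h a w z" and b: "climb g h b y z"
    and y: "y \<in> insert v (vertices h)"
    using connected_common_ancestor[OF assms] by blast
  show ?thesis
  proof (cases "a < r \<and> b < r")
    case True
    then show ?thesis using w a b unfolding danger_def near_def by blast
  next
    case False
    then have "deep g h r w \<or> deep g h r y" using climb_prefix[OF a] climb_prefix[OF b] by force
    then show ?thesis using w y by (auto simp: danger_def)
  qed
qed

text \<open>A vertex has one partner in each matching, hence at most \<open>d\<close>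
  children.\<close>

lemma card_climb:
  assumes "consistent \<sigma> h"
  shows "finite {y. climb g h b y z} \<and> card {y. climb g h b y z} \<le> d ^ b"
proof (induction b)
  case (Suc b)
  let ?S = "{y. climb g h b y z} \<times> {..<d}"
  have sub: "{y. climb g h (Suc b) y z} \<subseteq> (\<lambda>(p, j). \<sigma> (j, p)) ` ?S"
  proof
    fix y assume "y \<in> {y. climb g h (Suc b) y z}"
    then obtain p j where p: "parent h y = Some (p, j)" "climb g h b p z" by auto
    have "(p, j) \<in> ?S" "y = \<sigma> (j, p)" using consistent_entry[OF assms parent_entry[OF p(1)]] p(2) by auto
    then show "y \<in> (\<lambda>(p, j). \<sigma> (j, p)) ` ?S" by force
  qed
  have fin: "finite ?S" using Suc by simp
  have "card {y. climb g h (Suc b) y z} \<le> card ?S"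
    using card_mono[OF finite_imageI[OF fin] sub] card_image_le[OF fin] le_trans by blast
  also have "\<dots> \<le> d ^ b * d" using Suc by (simp add: card_cartesian_product)
  finally show ?case using finite_subset[OF sub finite_imageI[OF fin]] by (simp add: mult.commute)
qed simp

text \<open>The ancestor of \<open>w\<close> at height \<open>a\<close> is unique, so each triple
  \<open>(w, a, b)\<close> contributes the descendants of one vertex only, at most
  \<open>d ^ b\<close> of them.\<close>

lemma card_near:
  assumes h: "consistent \<sigma> h" and d: "d \<ge> 1"
  shows "finite (near r g h v)" "card (near r g h v) \<le> (card (surplus_ends h) + 1) * (r * r * d ^ r)"
proof -
  let ?W = "insert v (surplus_ends h)"
  let ?N = "\<lambda>w a b. {y. \<exists>z. climb g h a w z \<and> climb g h b y z}"
  have eq: "near r g h v = (\<Union>w\<in>?W. \<Union>a\<in>{..<r}. \<Union>b\<in>{..<r}. ?N w a b)"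
    unfolding near_def by blast
  have N: "finite (?N w a b) \<and> card (?N w a b) \<le> d ^ r" if "b < r" for w a b
  proof (cases "\<exists>z. climb g h a w z")
    case True
    then obtain z where z: "climb g h a w z" by blast
    then have "?N w a b = {y. climb g h b y z}" using climb_unique[OF z] by blast
    moreover have "d ^ b \<le> d ^ r" using that d by (intro power_increasing) auto
    ultimately show ?thesis using card_climb[OF h, of g b z] by simp
  next
    case False
    then have *: "?N w a b = {}" by blast
    show ?thesis unfolding * by simp
  qed
  show "finite (near r g h v)" unfolding eq using N by (intro finite_UN_I) auto
  have 1: "card (\<Union>b\<in>{..<r}. ?N w a b) \<le> r * d ^ r" for w a
    using card_UN_le[of "{..<r}" "?N w a"] sum_bounded_above[of "{..<r}" "\<lambda>b. card (?N w a b)" "d ^ r"] N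
    by (fastforce intro: le_trans)
  have 2: "card (\<Union>a\<in>{..<r}. \<Union>b\<in>{..<r}. ?N w a b) \<le> r * (r * d ^ r)" for w
    using card_UN_le[of "{..<r}" "\<lambda>a. \<Union>b\<in>{..<r}. ?N w a b"]
      sum_bounded_above[of "{..<r}" "\<lambda>a. card (\<Union>b\<in>{..<r}. ?N w a b)" "r * d ^ r"] 1
    by (fastforce intro: le_trans)
  have "card (near r g h v) \<le> card ?W * (r * (r * d ^ r))"
    unfolding eq
    using card_UN_le[of ?W "\<lambda>w. \<Union>a\<in>{..<r}. \<Union>b\<in>{..<r}. ?N w a b"]
      sum_bounded_above[of ?W "\<lambda>w. card (\<Union>a\<in>{..<r}. \<Union>b\<in>{..<r}. ?N w a b)" "r * (r * d ^ r)"] 2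
    by (fastforce intro: le_trans)
  also have "\<dots> \<le> (card (surplus_ends h) + 1) * (r * (r * d ^ r))"
    by (intro mult_le_mono1) (simp add: card_insert_if)
  finally show "card (near r g h v) \<le> (card (surplus_ends h) + 1) * (r * r * d ^ r)"
    by (simp add: mult.assoc)
qed

text \<open>An edge is bad iff its mark is \<open>0\<close>, so that uniform marks give bad edges probability \<open>1/M\<close>.\<close>

definition marks :: "nat \<Rightarrow> (edge \<Rightarrow> nat) set" where
  "marks M = edges \<rightarrow>\<^sub>E {..<M}"

definition good :: "(edge \<Rightarrow> nat) \<Rightarrow> edge set" where
  "good w = {e \<in> edges. w e \<noteq> 0}"

lemma finite_marks [simp]: "finite (marks M)"
  by (simp add: marks_def finite_PiE)

lemma card_marks_pos: "M > 0 \<Longrightarrow> card (marks M) > 0"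
  by (simp add: card_gt_0_iff) (auto simp: marks_def PiE_eq_empty_iff)

text \<open>Since \<open>Q\<close> ignores the mark of \<open>e\<close>, the \<open>M\<close>
  possible marks of \<open>e\<close> split the event \<open>Q\<close> into equal classes, of which
  goodness excludes one.\<close>

lemma card_marks_good:
  assumes e: "e \<in> edges" and Q: "\<And>w x. Q (w(e := x)) = Q w" and M: "M > 0"
  shows "real (card {w \<in> marks M. e \<in> good w \<and> Q w}) = (1 - 1 / M) * card {w \<in> marks M. Q w}"
proof -
  let ?A = "\<lambda>x. {w \<in> marks M. w e = x \<and> Q w}"
  have c: "card (?A x) = card (?A 0)" if "x < M" for x
  proof (rule bij_betw_same_card[where f = "\<lambda>w. w(e := 0)"], rule bij_betw_byWitness[where f' = "\<lambda>w. w(e := x)"])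
    show "(\<lambda>w. w(e := 0)) ` ?A x \<subseteq> ?A 0" "(\<lambda>w. w(e := x)) ` ?A 0 \<subseteq> ?A x"
      using e Q M that by (auto simp: marks_def PiE_def extensional_def Pi_def)
  qed auto
  have "w e < M" if "w \<in> marks M" for w
    using PiE_mem[of w edges "\<lambda>_. {..<M}" e] that e by (simp add: marks_def)
  then have U: "{w \<in> marks M. Q w} = (\<Union>x\<in>{..<M}. ?A x)" by blast
  have "card {w \<in> marks M. Q w} = (\<Sum>x<M. card (?A x))"
    unfolding U by (rule card_UN_disjoint) auto
  also have "\<dots> = (\<Sum>x<M. card (?A 0))" by (rule sum.cong[OF refl c]) simp
  also have "\<dots> = M * card (?A 0)" by simp
  finally have 1: "card {w \<in> marks M. Q w} = M * card (?A 0)" .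
  have 2: "{w \<in> marks M. Q w} = {w \<in> marks M. e \<in> good w \<and> Q w} \<union> ?A 0"
    using e by (auto simp: good_def)
  have "card {w \<in> marks M. Q w} = card {w \<in> marks M. e \<in> good w \<and> Q w} + card (?A 0)"
    by (subst 2, rule card_Un_disjoint) (auto simp: good_def)
  then have 3: "real (card {w \<in> marks M. Q w}) = real (card {w \<in> marks M. e \<in> good w \<and> Q w}) + real (card (?A 0))"
    unfolding of_nat_add[symmetric] by (rule arg_cong)
  have 4: "real (card {w \<in> marks M. Q w}) = real M * real (card (?A 0))"
    unfolding of_nat_mult[symmetric] 1 ..
  have "b = (1 - 1 / real M) * a" if "a = b + c" "a = real M * c" for a b c :: real
    using that M by (simp add: field_simps)
  from this[OF 3 4] show ?thesis .
qed

lemma climb_cong: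
  assumes "keys h \<inter> g = keys h \<inter> g'"
  shows "climb g h b y z = climb g' h b y z"
proof (induction b arbitrary: y)
  case (Suc b)
  have "edge_key p j y \<in> g \<longleftrightarrow> edge_key p j y \<in> g'" if "parent h y = Some (p, j)" for p j
    using parent_entry[OF that] assms by (force simp: keys_def)
  then show ?case using Suc by auto
qed simp

text \<open>A vertex just discovered is a leaf of the forest: no older parent pointer leads to
  it.\<close>

lemma climb_Cons_other:
  assumes "y \<notin> vertices h" "y' \<noteq> y"
  shows "climb g ((v, j, y) # h) b y' z = climb g h b y' z"
  using assms(2)
proof (induction b arbitrary: y')
  case (Suc b)
  have "parent ((v, j, y) # h) y' = parent h y'" using assms(1) Suc.prems by simp
  moreover have "p \<noteq> y" if "parent h y' = Some (p, i)" for p i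
    using entry_in_vertices[OF parent_entry[OF that]] assms(1) by blast
  ultimately show ?case using Suc.IH by (simp del: parent.simps) metis
qed simp

text \<open>Induction on the history with \<open>r\<close> and \<open>y\<close> free. From the
  newest vertex, the first step up uses a fresh edge, whose mark is independent of the remaining
  climb from \<open>v\<close> in the older history; this yields one factor \<open>1 - 1 / M\<close>.
  A chain may reach a root before \<open>r\<close> steps, hence only an inequality.\<close>

lemma card_deep:
  assumes \<sigma>: "\<sigma> \<in> matchings" and h: "consistent \<sigma> h" and M: "M > 0"
  shows "real (card {w \<in> marks M. deep (good w) h r y}) \<le> (1 - 1 / M) ^ r * card (marks M)"
  using h
proof (induction h arbitrary: r y)
  case Nil
  show ?case using M by (cases r) (auto simp: deep_def)
next
  case (Cons q h)
  obtain v j y0 where q: "q = (v, j, y0)" by (cases q)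
  have jv: "j < d" "v < 2*m" "y0 = \<sigma> (j, v)" and hh: "consistent \<sigma> h" and vt: "v \<notin> touched h j"
    using Cons.prems by (auto simp: q)
  have e: "edge_key v j y0 \<in> edges" "edge_key v j y0 \<notin> keys h"
    using edge_key_in_edges[OF \<sigma> jv(1,2)] touched_edge_key[OF \<sigma> hh jv(1,2)] vt jv(3) by auto
  note IH = Cons.IH[OF hh]
  show ?case
  proof (cases "y0 \<in> vertices h")
    case True
    then have p: "parent (q # h) = parent h" by (simp add: q)
    have "climb g (q # h) b x z = climb g h b x z" for g b x z
      by (induction b arbitrary: x) (simp_all del: parent.simps add: p)
    then have "deep g (q # h) r y = deep g h r y" for g by (simp add: deep_def)
    then show ?thesis using IH by simp
  next
    case new: False
    have other: "deep g (q # h) r x = deep g h r x" if "x \<noteq> y0" for g r x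
      using climb_Cons_other[OF new that] by (simp add: deep_def q)
    show ?thesis
    proof (cases "y = y0")
      case False
      then show ?thesis using IH other by simp
    next
      case y: True
      show ?thesis
      proof (cases r)
        case 0
        then show ?thesis by (simp add: card_mono)
      next
        case (Suc b)
        \<comment> \<open>The parent lies on the other side, so it is not the new leaf and its own
          climb can be read in \<open>h\<close>.\<close>
        have vy: "v \<noteq> y0" using matchings_side[OF \<sigma> jv(1,2)] jv(3) by auto
        have "deep g (q # h) r y \<longleftrightarrow> edge_key v j y0 \<in> g \<and> deep g (q # h) b v" for g
          using new by (auto simp: deep_def Suc y q)
        then have eq: "deep g (q # h) r y \<longleftrightarrow> edge_key v j y0 \<in> g \<and> deep g h b v" for g
          using other[OF vy] by simp
        have Q: "deep (good (w(edge_key v j y0 := x))) h b v = deep (good w) h b v" for w x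
        proof -
          have "keys h \<inter> good (w(edge_key v j y0 := x)) = keys h \<inter> good w"
            using e(2) by (auto simp: good_def)
          from climb_cong[OF this] show ?thesis by (simp add: deep_def)
        qed
        have "real (card {w \<in> marks M. deep (good w) (q # h) r y}) =
            (1 - 1 / M) * card {w \<in> marks M. deep (good w) h b v}"
          unfolding eq by (rule card_marks_good[OF e(1) Q M])
        also have "\<dots> \<le> (1 - 1 / M) * ((1 - 1 / M) ^ b * card (marks M))"
          using M by (intro mult_left_mono IH) simp
        finally show ?thesis by (simp add: Suc)
      qed
    qed
  qed
qed

text \<open>First moment over the marks for a fixed history: the \<open>near\<close> part is bounded
  for every marking, the \<open>deep\<close> parts by linearity. In \<open>+ 2\<close>, one unit
  stands for \<open>v\<close> as an additional starting point and one for the vertices that are deep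
  themselves.\<close>

lemma sum_card_danger:
  assumes \<sigma>: "\<sigma> \<in> matchings" and h: "consistent \<sigma> h" and M: "M > 0" and d: "d \<ge> 1"
    and q: "length h \<le> q"
  shows "(\<Sum>w\<in>marks M. real (card (danger r (good w) h v)))
    \<le> card (marks M) * ((card (surplus_ends h) + 2) * (r * r * d ^ r + (2 * q + 1) * (1 - 1 / M) ^ r))"
proof -
  let ?W = "insert v (surplus_ends h)" and ?V = "insert v (vertices h)"
  let ?D = "\<lambda>w y. of_bool (deep (good w) h r y) :: real"
  define \<rho> where "\<rho> = (1 - 1 / real M) ^ r"
  have \<rho>: "\<rho> \<ge> 0" using M by (simp add: \<rho>_def)
  have cW: "real (card ?W) \<le> card (surplus_ends h) + 1" by (simp add: card_insert_if)
  have cV: "real (card ?V) \<le> 2 * q + 1" using card_vertices[of h] q by (simp add: card_insert_if)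
  have one: "real (card (danger r (good w) h v)) \<le>
      (card (surplus_ends h) + 1) * (r * r * d ^ r) + (\<Sum>y\<in>?V. ?D w y) + card ?V * (\<Sum>x\<in>?W. ?D w x)" for w
  proof -
    let ?A = "{y \<in> ?V. deep (good w) h r y}" and ?B = "{y \<in> ?V. \<exists>x\<in>?W. deep (good w) h r x}"
    have eq: "danger r (good w) h v = near r (good w) h v \<union> (?A \<union> ?B)"
      by (auto simp: danger_def)
    have "card (danger r (good w) h v) \<le> card (near r (good w) h v) + (card ?A + card ?B)"
      unfolding eq using card_Un_le[of "near r (good w) h v" "?A \<union> ?B"] card_Un_le[of ?A ?B] by linarith
    moreover have "real (card ?A) = (\<Sum>y\<in>?V. ?D w y)"
      by (simp add: sum.If_cases of_bool_def Int_def del: sum.insert sum.insert_if)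
    \<comment> \<open>\<open>?B\<close> is either empty or all of \<open>?V\<close>. Bounding the
      existential by a sum of indicators makes it linear, so that expectations over the marks
      apply.\<close>
    moreover have "real (card ?B) \<le> card ?V * (\<Sum>x\<in>?W. ?D w x)"
    proof (cases "\<exists>x\<in>?W. deep (good w) h r x")
      case True
      then obtain x where x: "x \<in> ?W" "deep (good w) h r x" by blast
      have "1 \<le> (\<Sum>x\<in>?W. ?D w x)"
        using member_le_sum[of x ?W "?D w"] x by simp
      moreover have "card ?B \<le> card ?V" by (rule card_mono) auto
      ultimately have "real (card ?B) * 1 \<le> card ?V * (\<Sum>x\<in>?W. ?D w x)"
        by (intro mult_mono) auto
      then show ?thesis by simp
    next
      case False
      then have "?B = {}" by blast
      moreover have "0 \<le> (\<Sum>x\<in>?W. ?D w x)" by (rule sum_nonneg) simp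
      ultimately show ?thesis by (metis card.empty mult_nonneg_nonneg of_nat_0 of_nat_0_le_iff)
    qed
    moreover have "real (card (near r (good w) h v)) \<le> (card (surplus_ends h) + 1) * (r * r * d ^ r)"
      using card_near(2)[OF h d, of r "good w" v] by (metis of_nat_le_iff)
    ultimately show ?thesis by linarith
  qed
  have D: "(\<Sum>w\<in>marks M. ?D w y) \<le> \<rho> * card (marks M)" for y
    using card_deep[OF \<sigma> h M, of r y] by (simp add: \<rho>_def sum.If_cases of_bool_def Int_def)
  have S: "(\<Sum>w\<in>marks M. \<Sum>y\<in>X. ?D w y) \<le> card X * (\<rho> * card (marks M))" for X
    by (subst sum.swap) (use D in \<open>auto intro!: sum_bounded_above\<close>)
  have "(\<Sum>w\<in>marks M. real (card (danger r (good w) h v)))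
      \<le> (\<Sum>w\<in>marks M. (card (surplus_ends h) + 1) * (r * r * d ^ r) + (\<Sum>y\<in>?V. ?D w y) + card ?V * (\<Sum>x\<in>?W. ?D w x))"
    by (rule sum_mono[OF one])
  also have "\<dots> = card (marks M) * ((card (surplus_ends h) + 1) * (r * r * d ^ r))
      + (\<Sum>w\<in>marks M. \<Sum>y\<in>?V. ?D w y) + card ?V * (\<Sum>w\<in>marks M. \<Sum>x\<in>?W. ?D w x)"
    by (simp only: sum.distrib sum_constant sum_distrib_left[symmetric] of_nat_mult)
  also have "\<dots> \<le> card (marks M) * ((card (surplus_ends h) + 1) * (r * r * d ^ r))
      + card ?V * (\<rho> * card (marks M)) + card ?V * (card ?W * (\<rho> * card (marks M)))"
    by (intro add_mono mult_left_mono S) auto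
  also have "\<dots> = card (marks M) * ((card (surplus_ends h) + 1) * (r * r * d ^ r) + card ?V * ((card ?W + 1) * \<rho>))"
    by (simp only: algebra_simps of_nat_mult of_nat_add of_nat_1 mult_1_left mult_1_right)
  also have "\<dots> \<le> card (marks M) * ((card (surplus_ends h) + 2) * (r * r * d ^ r) + (2 * q + 1) * ((card (surplus_ends h) + 2) * \<rho>))"
    using cV cW \<rho> by (intro mult_left_mono add_mono mult_mono mult_right_mono) auto
  also have "\<dots> = card (marks M) * ((card (surplus_ends h) + 2) * (r * r * d ^ r + (2 * q + 1) * \<rho>))"
    by (simp only: algebra_simps of_nat_mult of_nat_add of_nat_1 mult_1_left mult_1_right)
  finally show ?thesis unfolding \<rho>_def by (simp add: add.commute)
qed

subsection \<open>Random matchings revealed adaptively\<close>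

text \<open>Uniform distribution on this set is the conditional distribution of the matchings after
  the answers in \<open>h\<close>.\<close>

definition extending :: "history \<Rightarrow> (nat \<times> nat \<Rightarrow> nat) set" where
  "extending h = {\<sigma> \<in> matchings. consistent \<sigma> h}"

lemma finite_extending [simp]: "finite (extending h)"
  by (simp add: extending_def)

lemma extending_Nil [simp]: "extending [] = matchings"
  by (simp add: extending_def)

lemma extending_Cons:
  assumes "j < d" "x < 2*m" "x \<notin> touched h j"
  shows "extending ((x, j, y) # h) = {\<sigma> \<in> extending h. \<sigma> (j, x) = y}"
  using assms by (auto simp: extending_def)

lemma consistent_cong:
  assumes "\<And>v j y. (v, j, y) \<in> set h \<Longrightarrow> \<sigma>' (j, v) = \<sigma> (j, v)"
  shows "consistent \<sigma>' h = consistent \<sigma> h"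
  using assms
proof (induction h)
  case (Cons q h)
  have "consistent \<sigma>' h = consistent \<sigma> h" using Cons by auto
  moreover have "\<sigma>' (j, v) = \<sigma> (j, v)" if "q = (v, j, y)" for v j y using Cons.prems that by auto
  ultimately show ?case by (cases q) auto
qed simp

lemma touched_partner:
  assumes \<sigma>: "\<sigma> \<in> extending h" and j: "j < d" and v: "v < 2*m"
  shows "v \<in> touched h j \<longleftrightarrow> \<sigma> (j, v) \<in> touched h j"
proof -
  have s: "\<sigma> \<in> matchings" "consistent \<sigma> h" using \<sigma> by (auto simp: extending_def)
  have "edge_key v j (\<sigma> (j, v)) = edge_key (\<sigma> (j, v)) j (\<sigma> (j, \<sigma> (j, v)))"
    using matchings_side[OF s(1) j v] matchings_involution[OF s(1) j v] by (auto simp: edge_key_def)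
  then show ?thesis
    using touched_edge_key[OF s j v] touched_edge_key[OF s j matchings_lt[OF s(1) j v]] by simp
qed

lemma touched_determined:
  assumes "v \<in> touched h j"
  shows "\<exists>y. \<forall>\<sigma>\<in>extending h. \<sigma> (j, v) = y"
proof -
  obtain y where y: "(v, j, y) \<in> set h \<or> (y, j, v) \<in> set h"
    using assms by (auto simp: touched_def)
  have "\<sigma> (j, v) = y" if "\<sigma> \<in> extending h" for \<sigma>
    using y
  proof
    have s: "\<sigma> \<in> matchings" "consistent \<sigma> h" using that by (auto simp: extending_def)
    {
      assume "(v, j, y) \<in> set h"
      from consistent_entry[OF s(2) this] show ?thesis by simp
    next
      assume "(y, j, v) \<in> set h"
      note e = consistent_entry[OF s(2) this]
      show ?thesis using matchings_involution[OF s(1) e(1,2)] e(3) by simp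
    }
  qed
  then show ?thesis by blast
qed

lemma card_touched: "card (touched h j) \<le> 2 * length h"
proof -
  have "touched h j \<subseteq> vertices h" using entry_in_vertices by (auto simp: touched_def)
  then show ?thesis using card_mono[OF finite_vertices] card_vertices le_trans by blast
qed

definition untouched_opposite :: "history \<Rightarrow> nat \<Rightarrow> nat \<Rightarrow> nat set" where
  "untouched_opposite h j x = {y. y < 2*m \<and> (y < m) \<noteq> (x < m)} - touched h j"

lemma card_untouched_opposite: "m - 2 * length h \<le> card (untouched_opposite h j x)"
proof -
  have eq: "{y. y < 2*m \<and> (y < m) \<noteq> (x < m)} = (if x < m then {m..<2*m} else {..<m})" by auto
  have c: "card {y. y < 2*m \<and> (y < m) \<noteq> (x < m)} = m" unfolding eq by simp
  have "touched h j \<subseteq> vertices h" using entry_in_vertices by (auto simp: touched_def)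
  then have "finite (touched h j)" by (rule finite_subset) simp
  from diff_card_le_card_Diff[OF this, of "{y. y < 2*m \<and> (y < m) \<noteq> (x < m)}"]
  show ?thesis using card_touched[of h j] unfolding untouched_opposite_def c by linarith
qed

text \<open>Conjugating the \<open>j\<close>-th matching by the transposition of two admissible answers exchanges
  them, so all admissible answers are equally likely.\<close>

lemma card_extending_answer_eq:
  assumes j: "j < d" and x: "x < 2*m" "x \<notin> touched h j"
    and y: "y \<in> untouched_opposite h j x" and y': "y' \<in> untouched_opposite h j x"
  shows "card (extending ((x, j, y) # h)) = card (extending ((x, j, y') # h))"
proof -
  define \<tau> where "\<tau> = Transposition.transpose y y'"
  define sw where "sw \<sigma> = restrict (\<lambda>(i, v). if i = j then \<tau> (\<sigma> (j, \<tau> v)) else \<sigma> (i, v)) ({..<d} \<times> {..<2*m})"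
    for \<sigma> :: "nat \<times> nat \<Rightarrow> nat"
  have yy: "y < 2*m" "y' < 2*m" "y < m \<longleftrightarrow> \<not> x < m" "y' < m \<longleftrightarrow> \<not> x < m" "y \<notin> touched h j" "y' \<notin> touched h j"
    using y y' by (auto simp: untouched_opposite_def)
  have \<tau>lt: "\<tau> v < 2*m \<longleftrightarrow> v < 2*m" and \<tau>side: "\<tau> v < m \<longleftrightarrow> v < m" and \<tau>\<tau>: "\<tau> (\<tau> v) = v" for v
    using yy by (auto simp: \<tau>_def Transposition.transpose_def)
  have \<tau>x: "\<tau> x = x" using yy by (auto simp: \<tau>_def Transposition.transpose_def)
  have \<tau>t: "\<tau> v = v" if "v \<in> touched h j" for v using yy that by (auto simp: \<tau>_def Transposition.transpose_def)
  have sw_app: "sw \<sigma> (i, v) = (if i = j then \<tau> (\<sigma> (j, \<tau> v)) else \<sigma> (i, v))" if "i < d" "v < 2*m" for \<sigma> i v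
    using that by (simp add: sw_def)
  have swm: "sw \<sigma> \<in> extending h" if \<sigma>: "\<sigma> \<in> extending h" for \<sigma>
  proof -
    have s: "\<sigma> \<in> matchings" "consistent \<sigma> h" using \<sigma> by (auto simp: extending_def)
    have lt: "sw \<sigma> (i, v) < 2*m" if "i < d" "v < 2*m" for i v
      using that matchings_lt[OF s(1), of i v] matchings_lt[OF s(1), of j "\<tau> v"] by (auto simp: sw_app \<tau>lt)
    have "sw \<sigma> \<in> matchings"
      unfolding matchings_def
    proof (intro CollectI conjI allI impI)
      show "sw \<sigma> \<in> {..<d} \<times> {..<2*m} \<rightarrow>\<^sub>E {..<2*m}"
        using lt by (auto simp: sw_def)
      fix i v assume iv: "i < d" "v < 2*m"
      show "(v < m) \<noteq> (sw \<sigma> (i, v) < m)"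
        using iv matchings_side[OF s(1) iv] matchings_side[OF s(1), of j "\<tau> v"]
        by (auto simp: sw_app \<tau>side \<tau>lt)
      show "sw \<sigma> (i, sw \<sigma> (i, v)) = v"
        using lt[OF iv] iv matchings_involution[OF s(1) iv] matchings_involution[OF s(1), of j "\<tau> v"]
        by (auto simp: sw_app \<tau>\<tau> \<tau>lt)
    qed
    moreover have "consistent (sw \<sigma>) h"
    proof (subst consistent_cong[where \<sigma> = \<sigma>])
      fix v i z assume e: "(v, i, z) \<in> set h"
      note ce = consistent_entry[OF s(2) e]
      show "sw \<sigma> (i, v) = \<sigma> (i, v)"
      proof (cases "i = j")
        case True
        then have "v \<in> touched h j" "z \<in> touched h j" using e by (auto simp: touched_def)
        then show ?thesis using ce True \<tau>t by (simp add: sw_app)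
      next
        case False
        then show ?thesis using ce(1,2) by (simp add: sw_app)
      qed
    qed (rule s)
    ultimately show ?thesis by (simp add: extending_def)
  qed
  have swsw: "sw (sw \<sigma>) = \<sigma>" if \<sigma>: "\<sigma> \<in> extending h" for \<sigma>
  proof
    fix p :: "nat \<times> nat"
    obtain i v where p: "p = (i, v)" by (cases p)
    have "\<sigma> \<in> {..<d} \<times> {..<2*m} \<rightarrow>\<^sub>E {..<2*m}" using \<sigma> by (auto simp: extending_def matchings_def)
    then have "\<sigma> (i, v) = undefined" if "\<not> (i < d \<and> v < 2*m)"
      using that by (auto simp: PiE_def extensional_def)
    moreover have "sw \<sigma>' (i, v) = undefined" if "\<not> (i < d \<and> v < 2*m)" for \<sigma>'
      using that by (auto simp: sw_def)
    ultimately show "sw (sw \<sigma>) p = \<sigma> p"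
      by (cases "i < d \<and> v < 2*m") (auto simp: p sw_app \<tau>\<tau> \<tau>lt)
  qed
  have swx: "sw \<sigma> (j, x) = \<tau> (\<sigma> (j, x))" for \<sigma> using j x by (simp add: sw_app \<tau>x)
  have "bij_betw sw {\<sigma> \<in> extending h. \<sigma> (j, x) = y} {\<sigma> \<in> extending h. \<sigma> (j, x) = y'}"
    by (rule bij_betw_byWitness[where f' = sw]) (use swm swsw swx in \<open>auto simp: \<tau>_def\<close>)
  then show ?thesis
    unfolding extending_Cons[OF j x] by (rule bij_betw_same_card)
qed

text \<open>An answer has conditional probability at most \<open>1 / (m - 2 * q)\<close>: admissible
  answers have equally many extensions and there are at least \<open>m - 2 * q\<close> of them,
  while an inadmissible answer has none.\<close>

lemma card_extending_answer:
  assumes j: "j < d" and x: "x < 2*m" "x \<notin> touched h j" and q: "length h \<le> q"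
  shows "(m - 2 * q) * card (extending ((x, j, y) # h)) \<le> card (extending h)"
proof (cases "y \<in> untouched_opposite h j x")
  case False
  have "\<sigma> (j, x) \<in> untouched_opposite h j x" if \<sigma>: "\<sigma> \<in> extending h" for \<sigma>
  proof -
    have s: "\<sigma> \<in> matchings" using \<sigma> by (auto simp: extending_def)
    show ?thesis
      using touched_partner[OF \<sigma> j x(1)] matchings_lt[OF s j x(1)] matchings_side[OF s j x(1)] x(2)
      by (auto simp: untouched_opposite_def)
  qed
  then have "extending ((x, j, y) # h) = {}" using False unfolding extending_Cons[OF j x] by blast
  then show ?thesis by simp
next
  case y: True
  let ?T = "untouched_opposite h j x"
  have fin: "finite ?T" by (simp add: untouched_opposite_def)
  have "(m - 2 * q) * card (extending ((x, j, y) # h)) \<le> card ?T * card (extending ((x, j, y) # h))"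
    using card_untouched_opposite[of h j x] q by (intro mult_le_mono1) linarith
  also have "\<dots> = (\<Sum>y'\<in>?T. card (extending ((x, j, y') # h)))"
    using card_extending_answer_eq[OF j x _ y] by simp
  also have "\<dots> = card (\<Union>y'\<in>?T. extending ((x, j, y') # h))"
    by (rule card_UN_disjoint[symmetric, OF fin]) (auto simp: extending_Cons[OF j x])
  also have "\<dots> \<le> card (extending h)"
    by (rule card_mono) (auto simp: extending_Cons[OF j x])
  finally show ?thesis .
qed

lemma sum_extending_split:
  fixes F :: "_ \<Rightarrow> real"
  assumes j: "j < d" and x: "x < 2*m" "x \<notin> touched h j"
  shows "(\<Sum>\<sigma>\<in>extending h. F \<sigma>) = (\<Sum>y<2*m. \<Sum>\<sigma>\<in>extending ((x, j, y) # h). F \<sigma>)"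
proof -
  have "(\<lambda>\<sigma>. \<sigma> (j, x)) ` extending h \<subseteq> {..<2*m}"
    using matchings_lt[OF _ j x(1)] by (auto simp: extending_def)
  from sum.group[OF finite_extending finite_lessThan this, of F]
  show ?thesis unfolding extending_Cons[OF j x] by simp
qed

text \<open>Optional stopping for an adaptive run. With \<open>u\<close> fixed, the matchings are
  the only randomness. A void query, or one to a known edge, gets the same answer from all
  extensions and does not branch; a fresh query splits \<open>extending h\<close> by its answer, and
  the hypothesis on \<open>Z\<close> pays for that step.\<close>

lemma explore_supermartingale:
  fixes Z :: "history \<Rightarrow> real"
  assumes Z: "\<And>h x j. length h < q \<Longrightarrow> j < d \<Longrightarrow> x < 2*m \<Longrightarrow> x \<notin> touched h j \<Longrightarrow>
      (\<Sum>\<sigma>\<in>extending h. Z ((x, j, \<sigma> (j, x)) # h)) \<le> card (extending h) * Z h"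
    and "\<And>\<sigma>. \<sigma> \<in> extending h \<Longrightarrow> length h + num_queries (labelled_graph \<sigma> u) t \<le> q"
  shows "(\<Sum>\<sigma>\<in>extending h. Z (explore \<sigma> u t h)) \<le> card (extending h) * Z h"
  using assms(2)
proof (induction t arbitrary: h)
  case (Query x i f)
  have m: "\<sigma> \<in> matchings" if "\<sigma> \<in> extending h" for \<sigma> h using that by (simp add: extending_def)
  have IH: "(\<Sum>\<sigma>\<in>extending h'. Z (explore \<sigma> u (f a) h')) \<le> card (extending h') * Z h'"
    if "\<And>\<sigma>. \<sigma> \<in> extending h' \<Longrightarrow> length h' + num_queries (labelled_graph \<sigma> u) (f a) \<le> q" for a h'
    by (rule Query.IH[OF _ that]) auto
  show ?case
  proof (cases "x < 2*m \<and> 1 \<le> i \<and> i \<le> d")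
    case False
    have a: "csp_oracle (labelled_graph \<sigma> u) x i = None" if "\<sigma> \<in> extending h" for \<sigma>
      using False csp_oracle_labelled_graph[OF m[OF that]] by auto
    have "explore \<sigma> u (Query x i f) h = explore \<sigma> u (f None) h" if "\<sigma> \<in> extending h" for \<sigma>
      using a[OF that] False by (simp split: if_split) blast
    then have "(\<Sum>\<sigma>\<in>extending h. Z (explore \<sigma> u (Query x i f) h)) = (\<Sum>\<sigma>\<in>extending h. Z (explore \<sigma> u (f None) h))"
      by (intro sum.cong refl) simp
    also have "\<dots> \<le> card (extending h) * Z h"
      by (rule IH) (use Query.prems a in fastforce)
    finally show ?thesis .
  next
    case xi: True
    define j where "j = i - 1"
    have j: "j < d" and x: "x < 2*m" using xi by (auto simp: j_def)
    define A where "A y = Some (let v = (if x < m then x else y) in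
        ((v, if x < m then y else x), (False, u (edge_key x j y))))" for y
    have a: "csp_oracle (labelled_graph \<sigma> u) x i = A (\<sigma> (j, x))" if "\<sigma> \<in> extending h" for \<sigma>
      using xi csp_oracle_labelled_graph[OF m[OF that]] by (auto simp: A_def j_def)
    show ?thesis
    proof (cases "x \<in> touched h j")
      case True
      then obtain y where y: "\<And>\<sigma>. \<sigma> \<in> extending h \<Longrightarrow> \<sigma> (j, x) = y"
        using touched_determined by blast
      have "explore \<sigma> u (Query x i f) h = explore \<sigma> u (f (A y)) h" if "\<sigma> \<in> extending h" for \<sigma>
        using a[OF that] y[OF that] True by (simp add: j_def)
      then have "(\<Sum>\<sigma>\<in>extending h. Z (explore \<sigma> u (Query x i f) h)) = (\<Sum>\<sigma>\<in>extending h. Z (explore \<sigma> u (f (A y)) h))"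
        by (intro sum.cong refl) simp
      also have "\<dots> \<le> card (extending h) * Z h"
        by (rule IH) (use Query.prems a y in fastforce)
      finally show ?thesis .
    next
      case xt: False
      let ?h = "\<lambda>y. (x, j, y) # h"
      have step: "explore \<sigma> u (Query x i f) h = explore \<sigma> u (f (A y)) (?h y)"
        "num_queries (labelled_graph \<sigma> u) (Query x i f) = Suc (num_queries (labelled_graph \<sigma> u) (f (A y)))"
        "\<sigma> \<in> extending h" if "\<sigma> \<in> extending (?h y)" for \<sigma> y
      proof -
        have s: "\<sigma> \<in> extending h" "\<sigma> (j, x) = y" using that unfolding extending_Cons[OF j x xt] by auto
        then show "\<sigma> \<in> extending h" by simp
        show "explore \<sigma> u (Query x i f) h = explore \<sigma> u (f (A y)) (?h y)"
          using a[OF s(1)] s(2) xi xt by (simp add: j_def)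
        show "num_queries (labelled_graph \<sigma> u) (Query x i f) = Suc (num_queries (labelled_graph \<sigma> u) (f (A y)))"
          using a[OF s(1)] s(2) by simp
      qed
      have "(\<Sum>\<sigma>\<in>extending h. Z (explore \<sigma> u (Query x i f) h))
          = (\<Sum>y<2*m. \<Sum>\<sigma>\<in>extending (?h y). Z (explore \<sigma> u (f (A y)) (?h y)))"
        unfolding sum_extending_split[OF j x xt] by (intro sum.cong refl) (simp only: step)
      also have "\<dots> \<le> (\<Sum>y<2*m. card (extending (?h y)) * Z (?h y))"
      proof (intro sum_mono IH)
        fix y \<sigma> assume "\<sigma> \<in> extending (?h y)"
        from step[OF this] Query.prems show "length (?h y) + num_queries (labelled_graph \<sigma> u) (f (A y)) \<le> q"
          by fastforce
      qed
      also have "\<dots> = (\<Sum>y<2*m. \<Sum>\<sigma>\<in>extending (?h y). Z (?h (\<sigma> (j, x))))"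
      proof (intro sum.cong refl)
        fix y
        have "(\<Sum>\<sigma>\<in>extending (?h y). Z (?h (\<sigma> (j, x)))) = (\<Sum>\<sigma>\<in>extending (?h y). Z (?h y))"
          by (intro sum.cong refl) (simp add: extending_Cons[OF j x xt])
        then show "card (extending (?h y)) * Z (?h y) = (\<Sum>\<sigma>\<in>extending (?h y). Z (?h (\<sigma> (j, x))))"
          by simp
      qed
      also have "\<dots> = (\<Sum>\<sigma>\<in>extending h. Z (?h (\<sigma> (j, x))))"
        unfolding sum_extending_split[OF j x xt] ..
      also have "\<dots> \<le> card (extending h) * Z h"
      \<comment> \<open>A compatible matching, if there is one, shows that the budget
        \<open>q\<close> still had room for this query; otherwise both sides vanish.\<close>
      proof (cases "extending h = {}")
        case False
        then have "length h < q" using Query.prems by fastforce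
        then show ?thesis by (rule Z[OF _ j x xt])
      qed simp
      finally show ?thesis .
    qed
  qed
qed simp

section \<open>Answers that fall into a set fixed before the query\<close>

primrec hits :: "(history \<Rightarrow> nat \<Rightarrow> nat set) \<Rightarrow> history \<Rightarrow> nat" where
  "hits B [] = 0"
| "hits B (q # h) = (case q of (v, j, y) \<Rightarrow> if y \<in> B h v then 1 else 0) + hits B h"

primrec exposure :: "(history \<Rightarrow> nat \<Rightarrow> nat set) \<Rightarrow> history \<Rightarrow> nat" where
  "exposure B [] = 0"
| "exposure B (q # h) = (case q of (v, j, y) \<Rightarrow> card (B h v)) + exposure B h"

text \<open>\<open>B\<close> depends on the history and the queried vertex, not on the answer, which
  therefore lands in it with conditional probability at most
  \<open>card (B h v) / (m - 2 * q)\<close>. So \<open>hits\<close> minus the rescaled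
  \<open>exposure\<close> is a supermartingale starting at 0.\<close>

lemma expected_hits:
  assumes q: "2 * q < m" and B: "\<And>\<sigma> h v. \<sigma> \<in> matchings \<Longrightarrow> consistent \<sigma> h \<Longrightarrow> finite (B h v)"
    and t: "\<And>\<sigma>. \<sigma> \<in> matchings \<Longrightarrow> num_queries (labelled_graph \<sigma> u) t \<le> q"
  shows "(\<Sum>\<sigma>\<in>matchings. real (hits B (explore \<sigma> u t [])))
    \<le> (\<Sum>\<sigma>\<in>matchings. real (exposure B (explore \<sigma> u t []))) / (m - 2 * q)"
proof -
  define c where "c = real (m - 2 * q)"
  have c: "c > 0" using q by (simp add: c_def)
  define Z where "Z h = hits B h - exposure B h / c" for h
  have step: "(\<Sum>\<sigma>\<in>extending h. Z ((x, j, \<sigma> (j, x)) # h)) \<le> card (extending h) * Z h"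
    if lq: "length h < q" and j: "j < d" and x: "x < 2*m" "x \<notin> touched h j" for h x j
  proof (cases "extending h = {}")
    case False
    then have fin: "finite (B h x)" using B by (auto simp: extending_def)
    have "(\<Sum>\<sigma>\<in>extending h. of_bool (\<sigma> (j, x) \<in> B h x) :: real) = card {\<sigma> \<in> extending h. \<sigma> (j, x) \<in> B h x}"
      by (simp add: of_bool_def sum.If_cases Int_def)
    also have "{\<sigma> \<in> extending h. \<sigma> (j, x) \<in> B h x} = (\<Union>y\<in>B h x. extending ((x, j, y) # h))"
      by (auto simp: extending_Cons[OF j x])
    also have "card \<dots> = (\<Sum>y\<in>B h x. card (extending ((x, j, y) # h)))"
      by (rule card_UN_disjoint[OF fin]) (auto simp: extending_Cons[OF j x])
    also have "real \<dots> \<le> (\<Sum>y\<in>B h x. card (extending h) / c)"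
    proof (unfold of_nat_sum, rule sum_mono)
      fix y
      have "c * card (extending ((x, j, y) # h)) \<le> card (extending h)"
        using card_extending_answer[OF j x, of q y] lq unfolding c_def
        by (metis less_or_eq_imp_le of_nat_le_iff of_nat_mult)
      then show "real (card (extending ((x, j, y) # h))) \<le> card (extending h) / c"
        using c by (simp add: field_simps)
    qed
    also have "\<dots> = card (extending h) * (card (B h x) / c)" by simp
    finally have 1: "(\<Sum>\<sigma>\<in>extending h. of_bool (\<sigma> (j, x) \<in> B h x) :: real) \<le> card (extending h) * (card (B h x) / c)" .
    have "(\<Sum>\<sigma>\<in>extending h. Z ((x, j, \<sigma> (j, x)) # h))
        = (\<Sum>\<sigma>\<in>extending h. of_bool (\<sigma> (j, x) \<in> B h x) + (Z h - card (B h x) / c))"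
      by (intro sum.cong refl) (simp add: Z_def add_divide_distrib)
    also have "\<dots> = (\<Sum>\<sigma>\<in>extending h. of_bool (\<sigma> (j, x) \<in> B h x)) + card (extending h) * (Z h - card (B h x) / c)"
      by (simp add: sum.distrib)
    also have "\<dots> \<le> card (extending h) * Z h"
      using 1 by (simp add: right_diff_distrib)
    finally show ?thesis .
  qed simp
  have "(\<Sum>\<sigma>\<in>matchings. Z (explore \<sigma> u t [])) \<le> card matchings * Z []"
    using explore_supermartingale[of q Z "[]" u t] step t by simp
  then show ?thesis
    unfolding Z_def c_def by (simp add: sum_subtractf sum_divide_distrib)
qed

lemma exposure_vertices: "exposure (\<lambda>h v. vertices h) h \<le> length h * (2 * length h)"
proof (induction h)
  case (Cons q h)
  have "exposure (\<lambda>h v. vertices h) (q # h) \<le> 2 * length h + length h * (2 * length h)"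
    using Cons card_vertices[of h] by (cases q) simp
  also have "\<dots> \<le> length (q # h) * (2 * length (q # h))" by simp
  finally show ?case .
qed simp

lemma card_surplus_ends: "card (surplus_ends h) \<le> 2 * hits (\<lambda>h v. vertices h) h"
proof (induction h)
  case (Cons q h)
  obtain v j y where q: "q = (v, j, y)" by (cases q)
  have "card ({v, y} \<union> surplus_ends h) \<le> card {v, y} + card (surplus_ends h)" by (rule card_Un_le)
  moreover have "card {v, y} \<le> 2" by (simp add: card_insert_if)
  ultimately have "card ({v, y} \<union> surplus_ends h) \<le> 2 + card (surplus_ends h)" by linarith
  then show ?case using Cons by (simp add: q)
qed simp

lemma cyclic_hits: "cyclic g h \<Longrightarrow> hits (danger r g) h \<ge> 1"
proof (induction h)
  case (Cons q h)
  obtain v j y where q: "q = (v, j, y)" by (cases q)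
  show ?case using Cons connected_in_danger[of v y g h r] by (auto simp: q)
qed simp

lemma surplus_ends_Cons: "surplus_ends h \<subseteq> surplus_ends (q # h)"
  by simp

text \<open>Surplus ends only accumulate, so their final number gives one bound for the danger set
  at every step.\<close>

lemma sum_exposure_danger:
  assumes \<sigma>: "\<sigma> \<in> matchings" and h: "consistent \<sigma> h" and M: "M > 0" and d: "d \<ge> 1"
    and q: "length h \<le> q"
  shows "(\<Sum>w\<in>marks M. real (exposure (danger r (good w)) h))
    \<le> length h * (card (marks M) * ((card (surplus_ends h) + 2) * (r * r * d ^ r + (2 * q + 1) * (1 - 1 / M) ^ r)))"
  using h q
proof (induction h)
  case (Cons p h)
  obtain v j y where p: "p = (v, j, y)" by (cases p)
  let ?b = "r * r * d ^ r + (2 * real q + 1) * (1 - 1 / real M) ^ r"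
  let ?X = "\<lambda>h. card (marks M) * ((card (surplus_ends h) + 2) * ?b)"
  have ch: "consistent \<sigma> h" and lq: "length h \<le> q" using Cons.prems by auto
  have "card (surplus_ends h) \<le> card (surplus_ends (p # h))"
    by (rule card_mono[OF finite_surplus_ends surplus_ends_Cons])
  then have X: "?X h \<le> ?X (p # h)"
    using M by (intro mult_left_mono mult_right_mono add_nonneg_nonneg) auto
  have "(\<Sum>w\<in>marks M. real (exposure (danger r (good w)) (p # h))) =
      (\<Sum>w\<in>marks M. real (card (danger r (good w) h v))) + (\<Sum>w\<in>marks M. real (exposure (danger r (good w)) h))"
    by (simp add: p sum.distrib)
  also have "\<dots> \<le> ?X h + length h * ?X h"
    using Cons.IH[OF ch lq] sum_card_danger[OF \<sigma> ch M d lq, of r v] by linarith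
  also have "\<dots> \<le> ?X (p # h) + length h * ?X (p # h)"
    by (intro add_mono mult_left_mono X) auto
  also have "\<dots> = length (p # h) * ?X (p # h)" by (simp add: algebra_simps)
  finally show ?case .
qed simp

text \<open>\<open>expected_hits\<close> is used twice: with all visited vertices as
  \<open>B\<close> it bounds the surplus ends, and with the danger set of a fixed marking it bounds
  the closings of good cycles. The sums are then exchanged, and the marks averaged for a fixed
  matching, since the history does not involve them.\<close>

lemma cyclic_bound:
  assumes q: "2 * q < m" and M: "M > 0" and d: "d \<ge> 1"
    and t: "\<And>\<sigma>. \<sigma> \<in> matchings \<Longrightarrow> num_queries (labelled_graph \<sigma> u) t \<le> q"
  shows "(\<Sum>\<sigma>\<in>matchings. \<Sum>w\<in>marks M. of_bool (cyclic (good w) (explore \<sigma> u t [])) :: real)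
    \<le> card matchings * card (marks M) *
      (q / (m - 2 * q) * (4 * q\<^sup>2 / (m - 2 * q) + 2) * (r * r * d ^ r + (2 * q + 1) * (1 - 1 / M) ^ r))"
proof -
  define c where "c = real (m - 2 * q)"
  have c: "c > 0" using q by (simp add: c_def)
  define \<beta> where "\<beta> = r * r * d ^ r + (2 * q + 1) * (1 - 1 / real M) ^ r"
  have \<beta>: "\<beta> \<ge> 0" using M unfolding \<beta>_def by (intro add_nonneg_nonneg mult_nonneg_nonneg zero_le_power) auto
  define H where "H \<sigma> = explore \<sigma> u t []" for \<sigma>
  have H: "consistent \<sigma> (H \<sigma>)" "length (H \<sigma>) \<le> q" if "\<sigma> \<in> matchings" for \<sigma>
    using explore_consistent[of \<sigma> "[]"] length_explore[of \<sigma> u t "[]"] t[OF that] by (auto simp: H_def)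
  let ?s = "\<lambda>\<sigma>. real (card (surplus_ends (H \<sigma>)))"
  \<comment> \<open>The 4 combines two ends per surplus edge with an exposure of at most
    \<open>2 * q\<^sup>2\<close>: each of \<open>q\<close> steps faces at most \<open>2 * q\<close>
    visited vertices.\<close>
  have surplus: "(\<Sum>\<sigma>\<in>matchings. ?s \<sigma>) \<le> card matchings * (4 * q\<^sup>2 / c)"
  proof -
    have "(\<Sum>\<sigma>\<in>matchings. ?s \<sigma>) \<le> (\<Sum>\<sigma>\<in>matchings. 2 * real (hits (\<lambda>h v. vertices h) (H \<sigma>)))"
      using card_surplus_ends by (intro sum_mono) (metis of_nat_le_iff of_nat_mult of_nat_numeral)
    also have "\<dots> = 2 * (\<Sum>\<sigma>\<in>matchings. real (hits (\<lambda>h v. vertices h) (H \<sigma>)))"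
      by (simp add: sum_distrib_left)
    also have "\<dots> \<le> 2 * ((\<Sum>\<sigma>\<in>matchings. real (exposure (\<lambda>h v. vertices h) (H \<sigma>))) / c)"
      unfolding H_def c_def by (intro mult_left_mono expected_hits[OF q _ t]) auto
    also have "\<dots> \<le> 2 * ((\<Sum>\<sigma>\<in>matchings. 2 * real q ^ 2) / c)"
    proof (intro mult_left_mono divide_right_mono sum_mono)
      fix \<sigma> assume \<sigma>: "\<sigma> \<in> matchings"
      have "exposure (\<lambda>h v. vertices h) (H \<sigma>) \<le> q * (2 * q)"
        by (rule le_trans[OF exposure_vertices mult_le_mono]) (use H(2)[OF \<sigma>] in auto)
      then have "real (exposure (\<lambda>h v. vertices h) (H \<sigma>)) \<le> real (q * (2 * q))" by (simp only: of_nat_le_iff)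
      then show "real (exposure (\<lambda>h v. vertices h) (H \<sigma>)) \<le> 2 * real q ^ 2" by (simp add: power2_eq_square)
    qed (use c in auto)
    finally show ?thesis by (simp add: mult_ac)
  qed
  have "(\<Sum>\<sigma>\<in>matchings. \<Sum>w\<in>marks M. of_bool (cyclic (good w) (H \<sigma>)) :: real)
      \<le> (\<Sum>\<sigma>\<in>matchings. \<Sum>w\<in>marks M. real (hits (danger r (good w)) (H \<sigma>)))"
    using cyclic_hits by (intro sum_mono) (auto simp: of_bool_def)
  also have "\<dots> = (\<Sum>w\<in>marks M. \<Sum>\<sigma>\<in>matchings. real (hits (danger r (good w)) (H \<sigma>)))"
    by (rule sum.swap)
  also have "\<dots> \<le> (\<Sum>w\<in>marks M. (\<Sum>\<sigma>\<in>matchings. real (exposure (danger r (good w)) (H \<sigma>))) / c)"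
    unfolding H_def c_def
    by (intro sum_mono expected_hits[OF q _ t]) (auto simp: danger_def dest: card_near(1)[OF _ d])
  also have "\<dots> = (\<Sum>\<sigma>\<in>matchings. \<Sum>w\<in>marks M. real (exposure (danger r (good w)) (H \<sigma>))) / c"
    unfolding sum_divide_distrib[symmetric] by (subst sum.swap) simp
  also have "\<dots> \<le> (\<Sum>\<sigma>\<in>matchings. q * (card (marks M) * ((?s \<sigma> + 2) * \<beta>))) / c"
  proof (intro divide_right_mono sum_mono)
    fix \<sigma> assume \<sigma>: "\<sigma> \<in> matchings"
    have "(\<Sum>w\<in>marks M. real (exposure (danger r (good w)) (H \<sigma>)))
        \<le> length (H \<sigma>) * (card (marks M) * ((?s \<sigma> + 2) * \<beta>))"
      using sum_exposure_danger[OF \<sigma> H(1)[OF \<sigma>] M d H(2)[OF \<sigma>], of r] by (simp add: \<beta>_def add_ac)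
    also have "\<dots> \<le> q * (card (marks M) * ((?s \<sigma> + 2) * \<beta>))"
      using H(2)[OF \<sigma>] \<beta> by (intro mult_right_mono mult_nonneg_nonneg) auto
    finally show "(\<Sum>w\<in>marks M. real (exposure (danger r (good w)) (H \<sigma>)))
        \<le> q * (card (marks M) * ((?s \<sigma> + 2) * \<beta>))" .
  qed (use c in auto)
  also have "\<dots> = q / c * card (marks M) * \<beta> * ((\<Sum>\<sigma>\<in>matchings. ?s \<sigma>) + card matchings * 2)"
  proof -
    have "(\<Sum>\<sigma>\<in>matchings. q * (card (marks M) * ((?s \<sigma> + 2) * \<beta>))) =
        (\<Sum>\<sigma>\<in>matchings. (q * card (marks M) * \<beta>) * (?s \<sigma> + 2))"
      by (intro sum.cong refl) (simp add: mult_ac)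
    also have "\<dots> = (q * card (marks M) * \<beta>) * ((\<Sum>\<sigma>\<in>matchings. ?s \<sigma>) + card matchings * 2)"
      by (simp only: sum_distrib_left[symmetric] sum.distrib sum_constant of_nat_mult of_nat_numeral)
    finally show ?thesis by simp
  qed
  also have "\<dots> \<le> q / c * card (marks M) * \<beta> * (card matchings * (4 * q\<^sup>2 / c) + card matchings * 2)"
    using c \<beta> surplus by (intro mult_left_mono add_right_mono) auto
  also have "\<dots> = card matchings * card (marks M) * (q / c * (4 * q\<^sup>2 / c + 2) * \<beta>)"
    by (simp add: algebra_simps)
  finally show ?thesis unfolding c_def \<beta>_def H_def by (simp add: add_ac)
qed

subsection \<open>Distance to satisfiability\<close>

lemma card_edges: "card edges = d * m"
  by (simp add: edges_def card_cartesian_product)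

lemma card_labellings: "card labellings = 2 ^ (d * m)"
  by (simp add: labellings_def card_PiE card_edges)

lemma length_constraints: "length (constraints (labelled_graph \<sigma> u)) = d * m"
  by (simp add: labelled_graph_def)

lemma constraint_nth:
  "k < d * m \<Longrightarrow> constraints (labelled_graph \<sigma> u) ! k =
    ((k mod m, \<sigma> (k div m, k mod m)), (False, u (k div m, k mod m)))"
  by (simp add: labelled_graph_def)

lemma position_edge: "k < d * m \<Longrightarrow> (k div m, k mod m) \<in> edges"
proof -
  assume k: "k < d * m"
  then have "m > 0" by (cases m) auto
  then show ?thesis using k by (simp add: edges_def less_mult_imp_div_less)
qed

lemma edge_position:
  assumes "(j, a) \<in> edges"
  shows "j * m + a < d * m" "(j * m + a) div m = j" "(j * m + a) mod m = a"
proof -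
  have ja: "j < d" "a < m" using assms by (auto simp: edges_def)
  have "j * m + a < Suc j * m" using ja by simp
  also have "\<dots> \<le> d * m" using ja by (intro mult_le_mono1) simp
  finally show "j * m + a < d * m" .
  show "(j * m + a) div m = j" "(j * m + a) mod m = a" using ja by auto
qed

definition violated :: "(nat \<times> nat \<Rightarrow> nat) \<Rightarrow> (nat \<Rightarrow> bool) \<Rightarrow> (edge \<Rightarrow> bool) \<Rightarrow> edge set" where
  "violated \<sigma> s u = {(j, a) \<in> edges. u (j, a) \<longleftrightarrow> s a \<noteq> s (\<sigma> (j, a))}"

lemma card_violated_le:
  assumes R: "R \<subseteq> {..<d * m}"
    and sat: "\<forall>k \<in> {..<length (constraints (labelled_graph \<sigma> u))} - R. constraint_sat xor2 s (constraints (labelled_graph \<sigma> u) ! k)"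
  shows "card (violated \<sigma> s u) \<le> card R"
proof -
  have "violated \<sigma> s u \<subseteq> (\<lambda>k. (k div m, k mod m)) ` R"
  proof
    fix e assume e: "e \<in> violated \<sigma> s u"
    obtain j a where ja: "e = (j, a)" by (cases e)
    have ed: "(j, a) \<in> edges" and v: "u (j, a) \<longleftrightarrow> s a \<noteq> s (\<sigma> (j, a))"
      using e by (auto simp: violated_def ja)
    note p = edge_position[OF ed]
    have "\<not> constraint_sat xor2 s (constraints (labelled_graph \<sigma> u) ! (j * m + a))"
      unfolding constraint_nth[OF p(1)] p(2,3) using v by (auto simp: xor2_def)
    then have "j * m + a \<in> R" using sat p(1) by (auto simp: length_constraints)
    then show "e \<in> (\<lambda>k. (k div m, k mod m)) ` R"
      using p(2,3) by (intro image_eqI[of _ _ "j * m + a"]) (auto simp: ja)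
  qed
  moreover have "finite R" using R by (rule finite_subset) simp
  ultimately show ?thesis by (meson card_image_le card_mono finite_imageI le_trans)
qed

text \<open>For fixed \<open>s\<close>, exactly one of the two labels of an edge is violated,
  independently over the edges, so the moment factorises.\<close>

lemma violated_exp_moment:
  fixes x :: real
  shows "(\<Sum>u\<in>labellings. exp (- x * card (violated \<sigma> s u))) = (1 + exp (- x)) ^ (d * m)"
proof -
  define T where "T e \<longleftrightarrow> s (snd e) \<noteq> s (\<sigma> e)" for e
  let ?f = "\<lambda>e b. if b = T e then exp (- x) else 1"
  have "exp (- x * card (violated \<sigma> s u)) = (\<Prod>e\<in>edges. ?f e (u e))" for u
  proof -
    have "violated \<sigma> s u = {e \<in> edges. u e = T e}" by (auto simp: violated_def T_def)
    then show ?thesis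
      by (simp add: prod.If_cases Int_def exp_of_nat_mult mult.commute flip: exp_of_nat2_mult)
  qed
  then have "(\<Sum>u\<in>labellings. exp (- x * card (violated \<sigma> s u))) = (\<Sum>u\<in>labellings. \<Prod>e\<in>edges. ?f e (u e))"
    by simp
  also have "\<dots> = (\<Prod>e\<in>edges. \<Sum>b\<in>UNIV. ?f e b)"
    unfolding labellings_def by (rule prod_sum_PiE[symmetric]) auto
  also have "\<dots> = (\<Prod>e\<in>edges. 1 + exp (- x))"
    by (rule prod.cong) (auto simp: UNIV_bool)
  finally show ?thesis by (simp add: card_edges)
qed

text \<open>Chernoff bound with parameter \<open>2 * a\<close>, the value for which
  \<open>cosh_bound\<close> is stated.\<close>

lemma card_few_violated:
  fixes a :: real
  assumes a: "0 \<le> a" "a \<le> 1"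
  shows "real (card {u \<in> labellings. card (violated \<sigma> s u) \<le> (1/2 - a) * (d * m)})
    \<le> card labellings * exp (- a\<^sup>2 * (d * m))"
proof -
  let ?S = "{u \<in> labellings. card (violated \<sigma> s u) \<le> (1/2 - a) * (d * m)}"
  define D where "D = real (d * m)"
  define K where "K = (1/2 - a) * D"
  have "card ?S * exp (- (2 * a) * K) = (\<Sum>u\<in>?S. exp (- (2 * a) * K))" by simp
  also have "\<dots> \<le> (\<Sum>u\<in>?S. exp (- (2 * a) * card (violated \<sigma> s u)))"
    using a by (intro sum_mono) (auto simp: K_def D_def intro!: mult_left_mono)
  also have "\<dots> \<le> (\<Sum>u\<in>labellings. exp (- (2 * a) * card (violated \<sigma> s u)))"
    by (rule sum_mono2) auto
  also have "\<dots> = (1 + exp (- (2 * a))) ^ (d * m)" by (rule violated_exp_moment)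
  also have "\<dots> \<le> (2 * exp (a\<^sup>2 - a)) ^ (d * m)"
    by (rule power_mono[OF cosh_bound[OF a]]) (simp add: add_nonneg_nonneg)
  also have "\<dots> = card labellings * exp (D * (a\<^sup>2 - a))"
    by (simp add: card_labellings power_mult_distrib D_def flip: exp_of_nat_mult)
  finally have le: "card ?S * exp (- (2 * a) * K) \<le> card labellings * exp (D * (a\<^sup>2 - a))" .
  have "real (card ?S) = card ?S * exp (- (2 * a) * K) * exp (2 * a * K)"
    by (simp add: mult.assoc flip: exp_add)
  also have "\<dots> \<le> card labellings * exp (D * (a\<^sup>2 - a)) * exp (2 * a * K)"
    by (rule mult_right_mono[OF le]) simp
  also have "\<dots> = card labellings * exp (D * (a\<^sup>2 - a) + 2 * a * K)"
    by (simp only: mult.assoc exp_add)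
  \<comment> \<open>The threshold contributes \<open>(a - 2 * a\<^sup>2) * D\<close>, so the linear
    terms cancel.\<close>
  also have "D * (a\<^sup>2 - a) + 2 * a * K = - a\<^sup>2 * D"
    by (simp add: K_def power2_eq_square algebra_simps)
  finally show ?thesis by (simp add: D_def)
qed

lemma violated_restrict:
  assumes \<sigma>: "\<sigma> \<in> matchings"
  shows "violated \<sigma> (restrict s {..<2*m}) u = violated \<sigma> s u"
proof -
  have "\<sigma> (j, a) < 2*m" "a < 2*m" if "(j, a) \<in> edges" for j a
    using matchings_lt[OF \<sigma>, of j a] that by (auto simp: edges_def)
  then show ?thesis by (auto simp: violated_def)
qed

text \<open>Union bound over all \<open>4 ^ m\<close> assignments. Only half of the slack,
  \<open>a = e / 2\<close>, goes into the Chernoff bound; the other half absorbs the isolated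
  variable of odd \<open>n\<close>, which raises the removal threshold without adding
  constraints.\<close>

lemma card_not_far:
  fixes e :: real
  assumes \<sigma>: "\<sigma> \<in> matchings" and n: "n \<le> 2*m + 1" and e: "0 < e" "e \<le> 1/2"
    and d: "e\<^sup>2 * d \<ge> 8" and m: "m \<ge> 11" "2 * e * m \<ge> 1"
  shows "real (card {u \<in> labellings. \<not> far_from_sat xor2 n d (1/2 - e) (labelled_graph \<sigma> u)}) \<le> card labellings / 10"
proof -
  define a where "a = e / 2"
  let ?B = "\<lambda>s. {u \<in> labellings. card (violated \<sigma> s u) \<le> (1/2 - a) * (d * m)}"
  let ?N = "{u \<in> labellings. \<not> far_from_sat xor2 n d (1/2 - e) (labelled_graph \<sigma> u)}"
  have sub: "?N \<subseteq> (\<Union>s\<in>assignments. ?B s)"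
  proof
    fix u assume u: "u \<in> ?N"
    then obtain R where R: "R \<subseteq> {..<d * m}" "satisfiable_without xor2 (labelled_graph \<sigma> u) R"
      "real (card R) < (1/2 - e) * d * n / 2"
      by (auto simp: far_from_sat_def length_constraints not_le)
    then obtain s where s: "\<forall>k \<in> {..<length (constraints (labelled_graph \<sigma> u))} - R.
        constraint_sat xor2 s (constraints (labelled_graph \<sigma> u) ! k)"
      by (auto simp: satisfiable_without_def)
    have "(1/2 - e) * d * n / 2 \<le> (1/2 - e) * d * (2 * m + 1) / 2"
      using n e by (intro divide_right_mono mult_left_mono) auto
    also have "\<dots> = d * ((1/2 - e) * (m + 1/2))" by (simp add: field_simps)
    also have "\<dots> \<le> d * ((1/2 - a) * m)"
    proof (rule mult_left_mono)
      have "(1/2 - e) * (m + 1/2) = (1/2 - a) * m + (1/4 - e * m / 2 - e / 2)"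
        by (simp add: a_def field_simps)
      then show "(1/2 - e) * (real m + 1/2) \<le> (1/2 - a) * m" using m(2) e by linarith
    qed simp
    also have "\<dots> = (1/2 - a) * (d * m)" by simp
    finally have "(1/2 - e) * d * n / 2 \<le> (1/2 - a) * (d * m)" .
    moreover have "real (card (violated \<sigma> s u)) \<le> card R"
      using card_violated_le[OF R(1) s] by simp
    ultimately have "card (violated \<sigma> s u) \<le> (1/2 - a) * (d * m)"
      using R(3) by linarith
    then have "u \<in> ?B (restrict s {..<2*m})" using u by (simp add: violated_restrict[OF \<sigma>])
    moreover have "restrict s {..<2*m} \<in> assignments" by (simp add: assignments_def)
    ultimately show "u \<in> (\<Union>s\<in>assignments. ?B s)" by blast
  qed
  have "card ?N \<le> (\<Sum>s\<in>assignments. card (?B s))"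
    using card_mono[OF _ sub] card_UN_le[of assignments ?B] by fastforce
  then have "real (card ?N) \<le> (\<Sum>s\<in>assignments. real (card (?B s)))"
    unfolding of_nat_sum[symmetric] by (simp only: of_nat_le_iff)
  also have "\<dots> \<le> (\<Sum>s\<in>assignments. card labellings * exp (- a\<^sup>2 * (d * m)))"
    using e by (intro sum_mono card_few_violated) (auto simp: a_def)
  also have "\<dots> = card labellings * (4 ^ m * exp (- a\<^sup>2 * (d * m)))"
    by (simp add: card_assignments power_mult)
  also have "\<dots> \<le> card labellings * (1 / 10)"
  proof (rule mult_left_mono)
    \<comment> \<open>One assignment fails with probability at most
      \<open>exp (- 2) ^ m \<le> (1 / 5) ^ m\<close>, which beats \<open>4 ^ m\<close>. Eleven is
      the first exponent with \<open>(4 / 5) ^ m \<le> 1 / 10\<close>.\<close>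
    have "2 \<le> a\<^sup>2 * d" using d by (simp add: a_def power2_eq_square)
    then have "2 * real m \<le> a\<^sup>2 * d * m" by (rule mult_right_mono) simp
    then have "exp (- a\<^sup>2 * (d * m)) \<le> exp (- (m * 2))" by simp
    also have "\<dots> = (1 / exp 2) ^ m" by (simp add: exp_minus exp_of_nat_mult field_simps)
    also have "\<dots> \<le> (1 / 5) ^ m"
      using exp_lower_Taylor_quadratic[of 2] by (intro power_mono) (auto simp: field_simps)
    finally have "4 ^ m * exp (- a\<^sup>2 * (d * m)) \<le> 4 ^ m * (1 / 5) ^ m"
      by (intro mult_left_mono) auto
    also have "\<dots> = (4 / 5) ^ m" by (simp flip: power_mult_distrib)
    also have "\<dots> \<le> (4 / 5) ^ 11" using m by (intro power_decreasing) auto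
    also have "\<dots> \<le> 1 / (10::real)" by (simp add: power_divide)
    finally show "4 ^ m * exp (- a\<^sup>2 * (d * m)) \<le> 1 / 10" .
  qed simp
  finally show ?thesis by simp
qed

lemma close_planted:
  fixes e :: real
  assumes n: "2*m \<le> n" and e: "0 < e" and bad: "real (card (edges - g)) \<le> e * (d * m)"
  shows "close_to_sat xor2 n d e (labelled_graph \<sigma> (planted \<sigma> g s u))"
proof -
  let ?I = "labelled_graph \<sigma> (planted \<sigma> g s u)"
  let ?R = "{k. k < d * m \<and> (k div m, k mod m) \<notin> g}"
  have "constraint_sat xor2 s (constraints ?I ! k)" if "k < d * m" "(k div m, k mod m) \<in> g" for k
    unfolding constraint_nth[OF that(1)] using position_edge[OF that(1)] that(2)
    by (auto simp: planted_def xor2_def)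
  then have "satisfiable_without xor2 ?I ?R"
    unfolding satisfiable_without_def by (intro exI[of _ s]) (auto simp: length_constraints)
  moreover have "card ?R \<le> card (edges - g)"
  proof (rule card_inj_on_le[where f = "\<lambda>k. (k div m, k mod m)"])
    show "inj_on (\<lambda>k. (k div m, k mod m)) ?R"
      by (rule inj_on_inverseI[where g = "\<lambda>(j, a). j * m + a"]) simp
    show "(\<lambda>k. (k div m, k mod m)) ` ?R \<subseteq> edges - g" using position_edge by auto
  qed simp
  moreover have "e * (d * m) \<le> e * d * n / 2"
  proof -
    have "e * d * (2 * m) \<le> e * d * n" using e n by (intro mult_left_mono) auto
    then show ?thesis by simp
  qed
  ultimately show ?thesis using bad
    unfolding close_to_sat_def by (intro exI[of _ ?R]) (auto simp: length_constraints)
qed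

text \<open>Markov's inequality: an edge is bad with probability \<open>1 / M \<le> e / 20\<close>,
  and by \<open>close_planted\<close> an instance can fail only if more than a fraction
  \<open>e\<close> of its edges is bad.\<close>

lemma card_not_close:
  fixes e :: real
  assumes n: "2*m \<le> n" and e: "0 < e" "e * M \<ge> 20" and M: "M > 0" and dm: "d * m > 0"
  shows "real (card {w \<in> marks M. \<not> close_to_sat xor2 n d e (labelled_graph \<sigma> (planted \<sigma> (good w) s u))})
    \<le> card (marks M) / 20"
proof -
  let ?B = "{w \<in> marks M. \<not> close_to_sat xor2 n d e (labelled_graph \<sigma> (planted \<sigma> (good w) s u))}"
  define D where "D = real (d * m)"
  have D: "D > 0" using dm unfolding D_def by (simp only: of_nat_0_less_iff)
  have bad: "real (card {w \<in> marks M. x \<notin> good w}) = card (marks M) / M" if "x \<in> edges" for x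
  proof -
    have "card (marks M) = card {w \<in> marks M. x \<in> good w} + card {w \<in> marks M. x \<notin> good w}"
      by (subst card_Un_disjoint[symmetric]) (auto intro: arg_cong[where f = card])
    moreover have "real (card {w \<in> marks M. x \<in> good w}) = (1 - 1 / M) * card (marks M)"
      using card_marks_good[OF that _ M, of "\<lambda>_. True"] by simp
    ultimately show ?thesis by (simp add: left_diff_distrib)
  qed
  have "card ?B * (e * D) \<le> (\<Sum>w\<in>?B. real (card (edges - good w)))"
  proof -
    have "e * D \<le> card (edges - good w)" if "w \<in> ?B" for w
      using close_planted[OF n e(1), of "good w" \<sigma> s u] that by (fastforce simp: D_def)
    then show ?thesis using sum_mono[of ?B "\<lambda>_. e * D"] by simp
  qed
  also have "\<dots> \<le> (\<Sum>w\<in>marks M. real (card (edges - good w)))"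
    by (rule sum_mono2) auto
  also have "\<dots> = (\<Sum>w\<in>marks M. \<Sum>x\<in>edges. of_bool (x \<notin> good w))"
    by (intro sum.cong refl) (simp add: of_bool_def sum.If_cases Diff_eq Compl_eq)
  also have "\<dots> = (\<Sum>x\<in>edges. real (card {w \<in> marks M. x \<notin> good w}))"
    by (subst sum.swap) (simp add: of_bool_def sum.If_cases Int_def)
  also have "\<dots> = D * (card (marks M) / M)"
    by (simp add: bad card_edges D_def)
  finally have "card ?B * e * D \<le> card (marks M) / M * D" by (simp add: mult_ac)
  then have "card ?B * e \<le> card (marks M) / M" using D by (simp only: mult_le_cancel_right_pos)
  then have "card ?B * (e * M) \<le> card (marks M)" using M by (simp add: field_simps)
  moreover have "real (card ?B) * 20 \<le> card ?B * (e * M)" using e by (intro mult_left_mono) auto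
  ultimately show ?thesis by linarith
qed

section \<open>Comparison of the two instance distributions\<close>

lemma reject_compare:
  fixes \<eta> :: real and r :: nat
  assumes t: "\<And>\<sigma> u. \<sigma> \<in> matchings \<Longrightarrow> num_queries (labelled_graph \<sigma> u) t \<le> q"
    and q: "2 * q < m" and M: "M > 0" and d: "d \<ge> 1"
  defines "\<eta> \<equiv> q / (m - 2 * q) * (4 * q\<^sup>2 / (m - 2 * q) + 2) * (r * r * d ^ r + (2 * q + 1) * (1 - 1 / M) ^ r)"
  shows "real (card (marks M) * card assignments) * (\<Sum>(\<sigma>, u)\<in>matchings \<times> labellings. of_bool (\<not> accepts (labelled_graph \<sigma> u) t) :: real)
      - \<eta> * (card matchings * card (marks M) * card assignments * card labellings)
    \<le> (\<Sum>(\<sigma>, w, s, u)\<in>matchings \<times> marks M \<times> assignments \<times> labellings.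
        of_bool (\<not> accepts (labelled_graph \<sigma> (planted \<sigma> (good w) s u)) t) :: real)"
proof -
  let ?rej = "\<lambda>\<sigma> u. of_bool (\<not> accepts (labelled_graph \<sigma> u) t) :: real"
  let ?cyc = "\<lambda>\<sigma> u w. of_bool (cyclic (good w) (explore \<sigma> u t [])) :: real"
  have one: "card assignments * (\<Sum>u\<in>labellings. ?rej \<sigma> u - ?cyc \<sigma> u w)
      \<le> (\<Sum>(s, u)\<in>assignments \<times> labellings. ?rej \<sigma> (planted \<sigma> (good w) s u))"
    if \<sigma>: "\<sigma> \<in> matchings" for \<sigma> w
  proof -
    let ?L = "{u \<in> labellings. \<not> accepts (labelled_graph \<sigma> u) t \<and> \<not> cyclic (good w) (explore \<sigma> u t [])}"
    let ?R = "{(s, u) \<in> assignments \<times> labellings. \<not> accepts (labelled_graph \<sigma> (planted \<sigma> (good w) s u)) t}"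
    have "(\<Sum>u\<in>labellings. ?rej \<sigma> u - ?cyc \<sigma> u w) \<le> (\<Sum>u\<in>labellings. of_bool (u \<in> ?L))"
      by (rule sum_mono) auto
    also have "\<dots> = real (card ?L)" by (simp add: of_bool_def sum.If_cases Int_def)
    finally have "card assignments * (\<Sum>u\<in>labellings. ?rej \<sigma> u - ?cyc \<sigma> u w) \<le> card assignments * real (card ?L)"
      by (rule mult_left_mono) simp
    also have "\<dots> \<le> real (card ?R)"
      unfolding of_nat_mult[symmetric] of_nat_le_iff by (rule reject_planted[OF \<sigma>])
    also have "\<dots> = (\<Sum>p\<in>assignments \<times> labellings. of_bool (p \<in> ?R))"
    proof -
      have "(assignments \<times> labellings) \<inter> {p. p \<in> ?R} = ?R" by blast
      then show ?thesis by (subst sum_of_bool_eq) simp_all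
    qed
    also have "\<dots> = (\<Sum>(s, u)\<in>assignments \<times> labellings. ?rej \<sigma> (planted \<sigma> (good w) s u))"
      by (rule sum.cong) auto
    finally show ?thesis .
  qed
  have cyc: "(\<Sum>u\<in>labellings. \<Sum>\<sigma>\<in>matchings. \<Sum>w\<in>marks M. ?cyc \<sigma> u w)
      \<le> card labellings * (card matchings * card (marks M) * \<eta>)"
    unfolding \<eta>_def by (intro sum_bounded_above cyclic_bound[OF q M d t])
  have prod: "(\<Sum>(\<sigma>, u)\<in>matchings \<times> labellings. ?rej \<sigma> u) = (\<Sum>\<sigma>\<in>matchings. \<Sum>u\<in>labellings. ?rej \<sigma> u)"
    by (rule sum.cartesian_product[symmetric])
  have "real (card (marks M) * card assignments) * (\<Sum>(\<sigma>, u)\<in>matchings \<times> labellings. ?rej \<sigma> u)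
      - \<eta> * (card matchings * card (marks M) * card assignments * card labellings)
      = card assignments * (card (marks M) * (\<Sum>\<sigma>\<in>matchings. \<Sum>u\<in>labellings. ?rej \<sigma> u)
          - card labellings * (card matchings * card (marks M) * \<eta>))"
    unfolding prod by (simp only: of_nat_mult algebra_simps)
  also have "\<dots> \<le> card assignments * (card (marks M) * (\<Sum>\<sigma>\<in>matchings. \<Sum>u\<in>labellings. ?rej \<sigma> u)
          - (\<Sum>u\<in>labellings. \<Sum>\<sigma>\<in>matchings. \<Sum>w\<in>marks M. ?cyc \<sigma> u w))"
    using cyc by (intro mult_left_mono) auto
  also have "\<dots> = (\<Sum>\<sigma>\<in>matchings. \<Sum>w\<in>marks M. card assignments * (\<Sum>u\<in>labellings. ?rej \<sigma> u - ?cyc \<sigma> u w))"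
  proof -
    have "(\<Sum>u\<in>labellings. \<Sum>\<sigma>\<in>matchings. \<Sum>w\<in>marks M. ?cyc \<sigma> u w)
        = (\<Sum>\<sigma>\<in>matchings. \<Sum>w\<in>marks M. \<Sum>u\<in>labellings. ?cyc \<sigma> u w)"
      by (subst sum.swap) (intro sum.cong refl sum.swap)
    moreover have "card (marks M) * (\<Sum>\<sigma>\<in>matchings. \<Sum>u\<in>labellings. ?rej \<sigma> u)
        = (\<Sum>\<sigma>\<in>matchings. \<Sum>w\<in>marks M. \<Sum>u\<in>labellings. ?rej \<sigma> u)"
      by (simp only: sum_constant sum_distrib_left)
    ultimately show ?thesis
      by (simp only: sum_distrib_left[symmetric] sum_subtractf)
  qed
  also have "\<dots> \<le> (\<Sum>\<sigma>\<in>matchings. \<Sum>w\<in>marks M. \<Sum>(s, u)\<in>assignments \<times> labellings. ?rej \<sigma> (planted \<sigma> (good w) s u))"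
    by (intro sum_mono one)
  also have "\<dots> = (\<Sum>(\<sigma>, w, s, u)\<in>matchings \<times> marks M \<times> assignments \<times> labellings. ?rej \<sigma> (planted \<sigma> (good w) s u))"
    by (simp add: sum.cartesian_product)
  finally show ?thesis .
qed

text \<open>Uniform instances are rejected with average probability at least
  \<open>2/3 * 9/10 = 3/5\<close>, planted ones with at most \<open>1/3 + 1/20 = 23/60\<close>.
  Passing from one model to the other loses \<open>\<eta>\<close>; as
  \<open>3/5 - 1/10 = 1/2\<close> exceeds \<open>23/60\<close>, the loss must be larger than
  \<open>1/10\<close>.\<close>

lemma tester_bound:
  fixes e :: real and M r :: nat
  assumes A: "csp_tester xor2 n d e (1/2 - e) A" and qb: "query_bound n d A q"
    and n: "2*m \<le> n" "n \<le> 2*m + 1" and e: "0 < e" "e \<le> 1/2" "e * M \<ge> 20" "e\<^sup>2 * d \<ge> 8"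
    and m: "m \<ge> 11" "2 * e * m \<ge> 1" and q: "2 * q < m"
  shows "q / (m - 2 * q) * (4 * q\<^sup>2 / (m - 2 * q) + 2) * (r * r * d ^ r + (2 * q + 1) * (1 - 1 / M) ^ r) > 1 / 10"
    (is "?\<eta> > _")
proof (rule ccontr)
  assume "\<not> ?\<eta> > 1 / 10"
  define \<eta> where "\<eta> = ?\<eta>"
  have \<eta>: "\<eta> \<le> 1 / 10" using \<open>\<not> ?\<eta> > 1 / 10\<close> by (simp add: \<eta>_def)
  have M: "M > 0" and d: "d \<ge> 1" using e by (auto intro: ccontr simp: Suc_le_eq)
  let ?X = "matchings \<times> marks M \<times> assignments \<times> labellings" and ?Y = "matchings \<times> labellings"
  let ?P = "\<lambda>(\<sigma>, w, s, u) t. \<not> accepts (labelled_graph \<sigma> (planted \<sigma> (good w) s u)) t"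
  let ?Q = "\<lambda>(\<sigma>, u) t. \<not> accepts (labelled_graph \<sigma> u) t"
  define T where "T = real (card matchings) * card (marks M) * card assignments * card labellings"
  have T: "T > 0"
    using matchings_nonempty card_marks_pos[OF M] assignments_nonempty labellings_nonempty
    by (simp add: T_def card_gt_0_iff)
  have BD: "labelled_graph \<sigma> u \<in> bounded_degree_instances n d" if "\<sigma> \<in> matchings" for \<sigma> u
    using labelled_graph_bounded_degree[OF that n(1)] .
  have compare: "real (card (marks M) * card assignments) * (\<Sum>y\<in>?Y. measure_pmf.prob A {t. ?Q y t}) - \<eta> * T
      \<le> (\<Sum>x\<in>?X. measure_pmf.prob A {t. ?P x t})"
  proof (rule pmf_average_compare)
    fix t assume t: "t \<in> set_pmf A"
    have "num_queries (labelled_graph \<sigma> u) t \<le> q" if "\<sigma> \<in> matchings" for \<sigma> u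
      using qb t BD[OF that] by (auto simp: query_bound_def)
    from reject_compare[OF this q M d, of r]
    show "real (card (marks M) * card assignments) * (\<Sum>y\<in>?Y. of_bool (?Q y t)) - \<eta> * T \<le> (\<Sum>x\<in>?X. of_bool (?P x t))"
      by (simp add: T_def \<eta>_def case_prod_unfold)
  qed auto
  have rej: "measure_pmf.prob A {t. \<not> accepts I t} = 1 - measure_pmf.prob A {t. accepts I t}" for I
    using measure_pmf.prob_compl[of "{t. accepts I t}" A] by (simp add: Compl_eq Diff_eq flip: Collect_neg_eq)
  have P: "measure_pmf.prob A {t. \<not> accepts I t} \<le> 1 / 3 + of_bool (\<not> close_to_sat xor2 n d e I)"
    if "I \<in> bounded_degree_instances n d" for I
  proof (cases "close_to_sat xor2 n d e I")
    case True
    then show ?thesis using A that by (auto simp: csp_tester_def rej)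
  next
    case False
    have "measure_pmf.prob A {t. \<not> accepts I t} \<le> 1" by simp
    also have "\<dots> \<le> 1 / 3 + of_bool (\<not> close_to_sat xor2 n d e I)" using False by simp
    finally show ?thesis .
  qed
  have Q: "2 / 3 * (1 - of_bool (\<not> far_from_sat xor2 n d (1/2 - e) I)) \<le> measure_pmf.prob A {t. \<not> accepts I t}"
    if "I \<in> bounded_degree_instances n d" for I
    using A that by (auto simp: csp_tester_def)
  have "(\<Sum>x\<in>?X. measure_pmf.prob A {t. ?P x t})
      = (\<Sum>\<sigma>\<in>matchings. \<Sum>s\<in>assignments. \<Sum>u\<in>labellings. \<Sum>w\<in>marks M.
          measure_pmf.prob A {t. \<not> accepts (labelled_graph \<sigma> (planted \<sigma> (good w) s u)) t})"
  proof -
    have "(\<Sum>x\<in>?X. measure_pmf.prob A {t. ?P x t}) = (\<Sum>\<sigma>\<in>matchings. \<Sum>w\<in>marks M. \<Sum>s\<in>assignments. \<Sum>u\<in>labellings.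
          measure_pmf.prob A {t. \<not> accepts (labelled_graph \<sigma> (planted \<sigma> (good w) s u)) t})"
      by (simp add: sum.cartesian_product case_prod_unfold)
    also have "\<dots> = (\<Sum>\<sigma>\<in>matchings. \<Sum>s\<in>assignments. \<Sum>w\<in>marks M. \<Sum>u\<in>labellings.
          measure_pmf.prob A {t. \<not> accepts (labelled_graph \<sigma> (planted \<sigma> (good w) s u)) t})"
      by (intro sum.cong refl sum.swap)
    also have "\<dots> = (\<Sum>\<sigma>\<in>matchings. \<Sum>s\<in>assignments. \<Sum>u\<in>labellings. \<Sum>w\<in>marks M.
          measure_pmf.prob A {t. \<not> accepts (labelled_graph \<sigma> (planted \<sigma> (good w) s u)) t})"
      by (intro sum.cong refl sum.swap)
    finally show ?thesis .
  qed
  also have "\<dots> \<le> (\<Sum>\<sigma>\<in>matchings. \<Sum>s\<in>assignments. \<Sum>u\<in>labellings. card (marks M) * (23 / 60))"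
  proof (intro sum_mono)
    fix \<sigma> s u assume \<sigma>: "\<sigma> \<in> matchings"
    let ?I = "\<lambda>w. labelled_graph \<sigma> (planted \<sigma> (good w) s u)"
    have "(\<Sum>w\<in>marks M. measure_pmf.prob A {t. \<not> accepts (?I w) t})
        \<le> (\<Sum>w\<in>marks M. 1 / 3 + of_bool (\<not> close_to_sat xor2 n d e (?I w)))"
      by (intro sum_mono P BD \<sigma>)
    also have "\<dots> = card (marks M) * (1 / 3) + card {w \<in> marks M. \<not> close_to_sat xor2 n d e (?I w)}"
      by (simp add: sum.distrib of_bool_def sum.If_cases Int_def)
    also have "\<dots> \<le> card (marks M) * (1 / 3) + card (marks M) / 20"
      using card_not_close[OF n(1) e(1,3) M, of \<sigma> s u] d m(1) by simp
    finally show "(\<Sum>w\<in>marks M. measure_pmf.prob A {t. \<not> accepts (?I w) t}) \<le> card (marks M) * (23 / 60)"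
      by simp
  qed
  also have "\<dots> = T * (23 / 60)" by (simp add: T_def)
  finally have upper: "(\<Sum>x\<in>?X. measure_pmf.prob A {t. ?P x t}) \<le> T * (23 / 60)" .
  have "real (card matchings) * (card labellings * (3 / 5)) = (\<Sum>\<sigma>\<in>matchings. card labellings * (3 / 5))" by simp
  also have "\<dots> \<le> (\<Sum>\<sigma>\<in>matchings. \<Sum>u\<in>labellings. measure_pmf.prob A {t. \<not> accepts (labelled_graph \<sigma> u) t})"
  proof (rule sum_mono)
    fix \<sigma> assume \<sigma>: "\<sigma> \<in> matchings"
    let ?far = "\<lambda>u. far_from_sat xor2 n d (1/2 - e) (labelled_graph \<sigma> u)"
    have "card labellings * (3 / 5) \<le> 2 / 3 * (card labellings - real (card {u \<in> labellings. \<not> ?far u}))"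
      using card_not_far[OF \<sigma> n(2) e(1,2,4) m] by simp
    also have "card labellings - real (card {u \<in> labellings. \<not> ?far u}) = (\<Sum>u\<in>labellings. 1 - of_bool (\<not> ?far u))"
      unfolding sum_subtractf by (simp add: sum.If_cases of_bool_def Int_def)
    also have "2 / 3 * \<dots> = (\<Sum>u\<in>labellings. 2 / 3 * (1 - of_bool (\<not> ?far u)))"
      by (rule sum_distrib_left)
    also have "\<dots> \<le> (\<Sum>u\<in>labellings. measure_pmf.prob A {t. \<not> accepts (labelled_graph \<sigma> u) t})"
      by (intro sum_mono Q BD \<sigma>)
    finally show "card labellings * (3 / 5) \<le> (\<Sum>u\<in>labellings. measure_pmf.prob A {t. \<not> accepts (labelled_graph \<sigma> u) t})" .
  qed
  also have "\<dots> = (\<Sum>y\<in>?Y. measure_pmf.prob A {t. ?Q y t})"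
    by (simp add: sum.cartesian_product case_prod_unfold)
  finally have "real (card (marks M) * card assignments) * (real (card matchings) * (card labellings * (3 / 5)))
      \<le> real (card (marks M) * card assignments) * (\<Sum>y\<in>?Y. measure_pmf.prob A {t. ?Q y t})"
    by (rule mult_left_mono) simp
  then have "T * (3 / 5) \<le> real (card (marks M) * card assignments) * (\<Sum>y\<in>?Y. measure_pmf.prob A {t. ?Q y t})"
    by (simp add: T_def mult_ac)
  with compare upper have "T * (3 / 5) - \<eta> * T \<le> T * (23 / 60)" by linarith
  moreover have "\<eta> * T \<le> 1 / 10 * T" using \<eta> T by (intro mult_right_mono) auto
  ultimately have "T * (3 / 5) - 1 / 10 * T \<le> T * (23 / 60)" by linarith
  then show False using T by simp
qed

end

subsection \<open>Choice of parameters\<close>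

lemma removal_bound_mono: "\<epsilon> \<le> \<epsilon>' \<Longrightarrow> \<epsilon> * real d * real n / 2 \<le> \<epsilon>' * real d * real n / 2"
  by (intro divide_right_mono mult_right_mono) auto

lemma close_to_sat_mono:
  "close_to_sat P n d \<epsilon> I \<Longrightarrow> \<epsilon> \<le> \<epsilon>' \<Longrightarrow> close_to_sat P n d \<epsilon>' I"
  unfolding close_to_sat_def by (meson order_trans removal_bound_mono)

lemma far_from_sat_antimono:
  "far_from_sat P n d \<epsilon>' I \<Longrightarrow> \<epsilon> \<le> \<epsilon>' \<Longrightarrow> far_from_sat P n d \<epsilon> I"
  unfolding far_from_sat_def by (meson order_trans removal_bound_mono)

lemma csp_tester_mono:
  assumes "csp_tester P n d \<gamma>' \<epsilon> A" "\<gamma> \<le> \<gamma>'" "\<epsilon> \<le> \<epsilon>'"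
  shows "csp_tester P n d \<gamma> \<epsilon>' A"
  using assms unfolding csp_tester_def by (meson close_to_sat_mono far_from_sat_antimono)

text \<open>With \<open>Q = n powr (1/2 + \<delta>)\<close> the loss has two parts. Short climbs
  give about \<open>n powr (- 3/8 + 3 * \<delta>)\<close> up to logarithms, small since
  \<open>\<delta> \<le> 1 / 64\<close>. Long climbs give
  \<open>Q\<^sup>2 / n * n powr (2 * \<delta> - 8 * \<delta>)\<close>, that is
  \<open>n powr (- 4 * \<delta>)\<close>.\<close>

lemma query_lower_bound:
  fixes e :: real and M d :: nat
  assumes e: "0 < e" "e \<le> 1 / 8" and M: "e * M \<ge> 20" and d: "e\<^sup>2 * d \<ge> 8"
  defines "\<delta> \<equiv> 1 / (64 * M * ln d)"
  shows "eventually (\<lambda>n. \<forall>A q. csp_tester xor2 n d e (1/2 - e) A \<longrightarrow> query_bound n d A q \<longrightarrow>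
    n powr (1/2 + \<delta>) \<le> q) sequentially"
proof -
  have M1: "M \<ge> 1" using M e by (auto intro!: Suc_leI gr0I)
  have "e\<^sup>2 \<le> 1" using e by (intro power_le_one) auto
  then have "e\<^sup>2 * d \<le> 1 * real d" by (intro mult_right_mono) auto
  then have d8: "real d \<ge> 8" using d by simp
  have "exp 1 \<le> real d" using exp_le d8 by linarith
  then have lnd: "ln d \<ge> 1" using d8 by (simp add: ln_ge_iff)
  have Ml: "64 \<le> 64 * (M * ln d)"
    using mult_mono[of 1 "real M" 1 "ln d"] M1 lnd by simp
  have \<delta>: "\<delta> > 0" "\<delta> \<le> 1 / 64"
    using M1 lnd Ml by (auto simp: \<delta>_def field_simps)
  define \<Phi> where "\<Phi> n = 4 * n powr (1/2+\<delta>) / n * (64 * n powr (2*\<delta>) + 2) *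
      ((ln n)^2 * n powr (1/8) + 3 * n powr (1/2+\<delta>) * (3 * n powr (- (8*\<delta>))))" for n :: real
  have "(\<Phi> \<longlongrightarrow> 0) at_top" unfolding \<Phi>_def using \<delta> by real_asymp
  then have "eventually (\<lambda>n. \<Phi> n < 1 / 10) at_top"
    by (rule order_tendstoD) simp
  moreover have "eventually (\<lambda>n::real. 2 * n powr (1/2+\<delta>) + 1/2 \<le> n / 4) at_top"
    using \<delta> by real_asymp
  moreover have "eventually (\<lambda>n::real. n \<ge> 100 \<and> e * (n - 1) \<ge> 1) at_top"
    using e by (intro eventually_conj eventually_ge_at_top) real_asymp
  ultimately have "eventually (\<lambda>n::real. \<Phi> n < 1 / 10 \<and> 2 * n powr (1/2+\<delta>) + 1/2 \<le> n / 4 \<and>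
      n \<ge> 100 \<and> e * (n - 1) \<ge> 1) at_top"
    by eventually_elim auto
  then have "eventually (\<lambda>n::nat. \<Phi> n < 1 / 10 \<and> 2 * n powr (1/2+\<delta>) + 1/2 \<le> n / 4 \<and>
      real n \<ge> 100 \<and> e * (real n - 1) \<ge> 1) sequentially"
    by (rule eventually_compose_filterlim[OF _ filterlim_real_sequentially])
  then show ?thesis
  proof (eventually_elim, intro allI impI)
    fix n A q
    assume "\<Phi> n < 1 / 10 \<and> 2 * n powr (1/2+\<delta>) + 1/2 \<le> n / 4 \<and> real n \<ge> 100 \<and> e * (real n - 1) \<ge> 1"
      and A: "csp_tester xor2 n d e (1/2 - e) A" "query_bound n d A q"
    then have n: "\<Phi> n < 1 / 10" "2 * n powr (1/2+\<delta>) + 1/2 \<le> n / 4" "real n \<ge> 100" "e * (real n - 1) \<ge> 1"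
      by auto
    show "n powr (1/2 + \<delta>) \<le> q"
    proof (rule ccontr)
      assume less: "\<not> n powr (1/2 + \<delta>) \<le> q"
      define Q where "Q = n powr (1/2 + \<delta>)"
      have qQ: "q \<le> Q" using less by (simp add: Q_def)
      define m where "m = n div 2"
      have nm: "2 * m \<le> n" "n \<le> 2 * m + 1" by (auto simp: m_def)
      then have "real n \<le> real (2 * m + 1)" by (simp only: of_nat_le_iff)
      then have m: "real n - 1 \<le> 2 * real m" by simp
      have "real m \<ge> 11" using n m by linarith
      then have m11: "m \<ge> 11" by simp
      have "e * (real n - 1) \<le> e * (2 * m)" using e m by (intro mult_left_mono) auto
      then have em: "2 * e * m \<ge> 1" using n by linarith
      have gap: "real m - 2 * q \<ge> n / 4" using n m qQ unfolding Q_def by linarith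
      then have "real (2 * q) < real m" using n by simp
      then have q: "2 * q < m" by (simp only: of_nat_less_iff)
      have c: "real (m - 2 * q) \<ge> n / 4" using gap q by (simp add: of_nat_diff)
      \<comment> \<open>The choice balances \<open>d ^ r \<le> n powr (1 / 8)\<close> against the
        decay of \<open>(1 - 1 / M) ^ r\<close>; \<open>\<delta>\<close> is defined so that
        \<open>x / M = 8 * \<delta> * ln n\<close>. Rounding \<open>x\<close> down costs a factor
        \<open>exp (1 / M) \<le> 3\<close>.\<close>
      define x where "x = ln n / (8 * ln d)"
      define r where "r = nat \<lfloor>x\<rfloor>"
      have x: "0 \<le> x" "x \<le> ln n" using n lnd
        by (auto simp: x_def divide_le_eq intro!: divide_nonneg_nonneg mult_le_cancel_left1[THEN iffD2])
      have r: "real r \<le> x" "x - 1 \<le> r" using x(1) by (auto simp: r_def)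
      have "real d ^ r = exp (r * ln d)" using d8 by (simp add: exp_of_nat_mult)
      also have "\<dots> \<le> exp (x * ln d)" using r lnd by simp
      also have "\<dots> = n powr (1 / 8)" using lnd n by (simp add: x_def powr_def)
      finally have dr: "real d ^ r \<le> n powr (1 / 8)" .
      have "(1 - 1 / real M) ^ r \<le> exp (- (1 / real M)) ^ r"
        using M1 exp_ge_add_one_self[of "- (1 / real M)"] by (intro power_mono) auto
      also have "\<dots> = exp (- (r / M))" by (simp flip: exp_of_nat_mult)
      also have "\<dots> \<le> exp (1 / M - x / M)"
        using r(2) M1 by (simp add: field_simps)
      also have "\<dots> = exp (1 / M) * exp (- (x / M))" by (simp flip: exp_add)
      also have "\<dots> \<le> 3 * exp (- (x / M))"
      proof (rule mult_right_mono)
        have "exp (1 / real M) \<le> exp 1" using M1 by simp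
        then show "exp (1 / real M) \<le> 3" using exp_le by linarith
      qed simp
      also have "x / M = 8 * \<delta> * ln n" using M1 lnd by (simp add: x_def \<delta>_def field_simps)
      also have "exp (- (8 * \<delta> * ln n)) = n powr (- (8 * \<delta>))" using n by (simp add: powr_def)
      finally have \<rho>: "(1 - 1 / real M) ^ r \<le> 3 * n powr (- (8 * \<delta>))" .
      have "1 \<le> Q" using n \<delta> unfolding Q_def by (intro ge_one_powr_ge_zero) auto
      then have q3: "2 * q + 1 \<le> 3 * Q" using qQ by linarith
      have n0: "real n > 0" using n by linarith
      have rr: "real r * r \<le> (ln n)\<^sup>2"
        using r x unfolding power2_eq_square by (intro mult_mono) auto
      have "real (r * r * d ^ r) \<le> (ln n)\<^sup>2 * n powr (1 / 8)"
        using mult_mono[OF rr dr] by simp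
      moreover have "(2 * q + 1) * (1 - 1 / real M) ^ r \<le> 3 * Q * (3 * n powr (- (8 * \<delta>)))"
        using M1 q3 \<rho> \<open>1 \<le> Q\<close> by (intro mult_mono) auto
      ultimately have 1: "r * r * d ^ r + (2 * q + 1) * (1 - 1 / real M) ^ r
          \<le> (ln n)\<^sup>2 * n powr (1 / 8) + 3 * Q * (3 * n powr (- (8 * \<delta>)))"
        by simp
      have 2: "q / (m - 2 * q) \<le> 4 * Q / n"
      proof -
        have "q / (m - 2 * q) \<le> Q / (n / 4)" using qQ c n0 by (intro frac_le) auto
        then show ?thesis by (simp add: mult.commute)
      qed
      have "4 * q\<^sup>2 / (m - 2 * q) \<le> 4 * Q\<^sup>2 / (n / 4)"
        using qQ c n0 by (intro frac_le mult_left_mono power_mono) auto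
      also have "\<dots> = 16 * (Q\<^sup>2 / n)" by simp
      also have "Q\<^sup>2 = n powr (2 * \<delta>) * n"
      proof -
        have "Q\<^sup>2 = n powr ((1/2 + \<delta>) + (1/2 + \<delta>))" unfolding Q_def power2_eq_square powr_add ..
        also have "(1/2 + \<delta>) + (1/2 + \<delta>) = 2 * \<delta> + 1" by simp
        also have "n powr (2 * \<delta> + 1) = n powr (2 * \<delta>) * n" unfolding powr_add using n0 by simp
        finally show ?thesis .
      qed
      also have "16 * (n powr (2 * \<delta>) * n / n) = 16 * n powr (2 * \<delta>)" using n0 by simp
      also have "\<dots> \<le> 64 * n powr (2 * \<delta>)" by simp
      finally have 3: "4 * q\<^sup>2 / (m - 2 * q) + 2 \<le> 64 * n powr (2 * \<delta>) + 2" by simp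
      have "q / (m - 2 * q) * (4 * q\<^sup>2 / (m - 2 * q) + 2) * (r * r * d ^ r + (2 * q + 1) * (1 - 1 / real M) ^ r)
          \<le> 4 * Q / n * (64 * n powr (2 * \<delta>) + 2) * ((ln n)\<^sup>2 * n powr (1 / 8) + 3 * Q * (3 * n powr (- (8 * \<delta>))))"
        using 1 2 3 M1 n0 \<open>1 \<le> Q\<close>
        by (intro mult_mono add_nonneg_nonneg mult_nonneg_nonneg divide_nonneg_nonneg zero_le_power) auto
      also have "\<dots> = \<Phi> n" by (simp add: \<Phi>_def Q_def)
      also have "\<dots> < 1 / 10" by (rule n)
      finally show False
        using regular_instances.tester_bound[OF A nm e(1) _ M d m11 em q, of r] e(2) by (simp add: add.commute)
    qed
  qed
qed

theorem theorem2:
  "\<exists>(\<delta> :: real \<Rightarrow> real) (d :: real \<Rightarrow> nat).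
     (\<forall>\<epsilon>>0. \<delta> \<epsilon> > 0 \<and> d \<epsilon> > 0) \<and>
     \<delta> \<in> O[at_right 0](\<lambda>\<epsilon>. \<epsilon> / ln (2 / \<epsilon>\<^sup>2)) \<and>
     (\<lambda>\<epsilon>. real (d \<epsilon>)) \<in> O[at_right 0](\<lambda>\<epsilon>. 1 / \<epsilon>\<^sup>2) \<and>
     (\<forall>\<epsilon>>0. \<forall>(T :: nat \<Rightarrow> oracle_alg pmf) (q :: nat \<Rightarrow> nat).
        (\<forall>n>0. csp_tester xor2 n (d \<epsilon>) \<epsilon> (1/2 - \<epsilon>) (T n) \<and> query_bound n (d \<epsilon>) (T n) (q n))
        \<longrightarrow> (\<lambda>n. real (q n)) \<in> \<Omega>(\<lambda>n. real n powr (1/2 + \<delta> \<epsilon>)))"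
proof -
  \<comment> \<open>The cap yields witnesses for every positive \<open>\<epsilon>\<close>: by
    \<open>csp_tester_mono\<close> a tester for \<open>\<epsilon>\<close> is one for the smaller
    \<open>e \<epsilon>\<close>. Near 0, where the asymptotic claims live, the cap is
    inactive.\<close>
  define e where "e \<epsilon> = min \<epsilon> (1 / 8)" for \<epsilon> :: real
  define M where "M \<epsilon> = nat \<lceil>20 / e \<epsilon>\<rceil>" for \<epsilon>
  define d where "d \<epsilon> = nat \<lceil>8 / (e \<epsilon>)\<^sup>2\<rceil>" for \<epsilon>
  define \<delta> where "\<delta> \<epsilon> = 1 / (64 * M \<epsilon> * ln (d \<epsilon>))" for \<epsilon>
  have e: "0 < e \<epsilon>" "e \<epsilon> \<le> 1 / 8" "e \<epsilon> \<le> \<epsilon>" if "\<epsilon> > 0" for \<epsilon>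
    using that by (auto simp: e_def)
  have M: "real (M \<epsilon>) \<ge> 20 / e \<epsilon>" for \<epsilon> unfolding M_def by linarith
  have d: "real (d \<epsilon>) \<ge> 8 / (e \<epsilon>)\<^sup>2" for \<epsilon> unfolding d_def by linarith
  have eM: "e \<epsilon> * M \<epsilon> \<ge> 20" and ed: "(e \<epsilon>)\<^sup>2 * d \<epsilon> \<ge> 8" if "\<epsilon> > 0" for \<epsilon>
    using M[of \<epsilon>] d[of \<epsilon>] e[OF that] by (simp_all add: pos_divide_le_eq mult.commute)
  have pos: "\<delta> \<epsilon> > 0 \<and> d \<epsilon> > 0" if "\<epsilon> > 0" for \<epsilon>
  proof -
    have "(e \<epsilon>)\<^sup>2 \<le> 1" using e[OF that] by (intro power_le_one) auto
    then have "8 \<le> 8 / (e \<epsilon>)\<^sup>2" using e[OF that] by (simp add: field_simps)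
    then have "real (d \<epsilon>) \<ge> 8" using d[of \<epsilon>] by linarith
    moreover have "M \<epsilon> > 0" using eM[OF that] by (auto intro!: gr0I)
    ultimately show ?thesis by (simp add: \<delta>_def)
  qed
  have small: "eventually (\<lambda>\<epsilon>::real. 0 < \<epsilon> \<and> \<epsilon> < 1 / 8) (at_right 0)"
    using eventually_at_right_real[of 0 "1 / 8 :: real"] by simp
  have "\<delta> \<in> O[at_right 0](\<lambda>\<epsilon>. \<epsilon> / ln (2 / \<epsilon>\<^sup>2))"
  proof (rule bigoI[where c = 1], use small in eventually_elim)
    fix \<epsilon> :: real
    assume \<epsilon>: "0 < \<epsilon> \<and> \<epsilon> < 1 / 8"
    then have e\<epsilon>: "e \<epsilon> = \<epsilon>" by (simp add: e_def)
    have "\<epsilon>\<^sup>2 \<le> 1" using \<epsilon> by (intro power_le_one) auto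
    then have "1 < 2 / \<epsilon>\<^sup>2" using \<epsilon> by (simp add: field_simps)
    then have ln1: "0 < ln (2 / \<epsilon>\<^sup>2)" by (rule ln_gt_zero)
    have "2 / \<epsilon>\<^sup>2 \<le> 8 / \<epsilon>\<^sup>2" by (intro divide_right_mono) auto
    then have "2 / \<epsilon>\<^sup>2 \<le> d \<epsilon>" using d[of \<epsilon>] by (simp add: e\<epsilon>)
    then have ln2: "ln (2 / \<epsilon>\<^sup>2) \<le> ln (d \<epsilon>)" using \<open>1 < 2 / \<epsilon>\<^sup>2\<close> by (intro ln_mono) auto
    have "20 / \<epsilon> * ln (2 / \<epsilon>\<^sup>2) \<le> M \<epsilon> * ln (d \<epsilon>)"
      using M[of \<epsilon>] ln1 ln2 \<epsilon> by (intro mult_mono) (auto simp: e\<epsilon>)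
    moreover have "1 / \<epsilon> * ln (2 / \<epsilon>\<^sup>2) \<le> 20 / \<epsilon> * ln (2 / \<epsilon>\<^sup>2)"
      using ln1 \<epsilon> by (intro mult_right_mono divide_right_mono) auto
    moreover have "0 < 1 / \<epsilon> * ln (2 / \<epsilon>\<^sup>2)" using ln1 \<epsilon> by simp
    ultimately have "1 / (64 * (M \<epsilon> * ln (d \<epsilon>))) \<le> 1 / (1 / \<epsilon> * ln (2 / \<epsilon>\<^sup>2))"
      by (intro frac_le) auto
    then show "norm (\<delta> \<epsilon>) \<le> 1 * norm (\<epsilon> / ln (2 / \<epsilon>\<^sup>2))"
      using pos[of \<epsilon>] \<epsilon> ln1 by (simp add: \<delta>_def mult.assoc)
  qed
  moreover have "(\<lambda>\<epsilon>. real (d \<epsilon>)) \<in> O[at_right 0](\<lambda>\<epsilon>. 1 / \<epsilon>\<^sup>2)"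
  proof (rule bigoI[where c = 9], use small in eventually_elim)
    fix \<epsilon> :: real
    assume \<epsilon>: "0 < \<epsilon> \<and> \<epsilon> < 1 / 8"
    have "\<epsilon>\<^sup>2 \<le> 1" using \<epsilon> by (intro power_le_one) auto
    then have "1 \<le> 1 / \<epsilon>\<^sup>2" using \<epsilon> by (simp add: field_simps)
    \<comment> \<open>Rounding up adds at most 1, which is at most
      \<open>1 / \<epsilon>\<^sup>2\<close>; hence the constant 9.\<close>
    moreover have "real (d \<epsilon>) \<le> 8 / \<epsilon>\<^sup>2 + 1"
      using \<epsilon> unfolding d_def e_def by (simp add: min_absorb1)
    ultimately show "norm (real (d \<epsilon>)) \<le> 9 * norm (1 / \<epsilon>\<^sup>2)" by simp
  qed
  moreover have "(\<lambda>n. real (q n)) \<in> \<Omega>(\<lambda>n. real n powr (1/2 + \<delta> \<epsilon>))"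
    if \<epsilon>: "\<epsilon> > 0" and T: "\<forall>n>0. csp_tester xor2 n (d \<epsilon>) \<epsilon> (1/2 - \<epsilon>) (T n) \<and> query_bound n (d \<epsilon>) (T n) (q n)"
    for \<epsilon> T q
  proof (rule landau_omega.bigI[where c = 1])
    show "eventually (\<lambda>n. norm (real (q n)) \<ge> 1 * norm (real n powr (1/2 + \<delta> \<epsilon>))) sequentially"
      using query_lower_bound[OF e(1,2)[OF \<epsilon>] eM[OF \<epsilon>] ed[OF \<epsilon>]] eventually_gt_at_top[of 0]
    proof eventually_elim
      case (elim n)
      have "csp_tester xor2 n (d \<epsilon>) (e \<epsilon>) (1/2 - e \<epsilon>) (T n)"
        using csp_tester_mono[of xor2 n "d \<epsilon>" \<epsilon> "1/2 - \<epsilon>" "T n"] T elim(2) e(3)[OF \<epsilon>] by simp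
      then show ?case using elim T by (simp add: \<delta>_def)
    qed
  qed simp
  ultimately show ?thesis using pos by blast
qed

end
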